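(* Let $(L^\infty(X),\Delta)$ be a commutative Hopf von Neumann algebra and let $K_{\mathrm{AP}}$ be the compact Hausdorff space with $\mathrm{AP}(L^1(X))=C(K_{\mathrm{AP}})$. Then $\Delta$ restricts to a map $C(K_{\mathrm{AP}})\to C(K_{\mathrm{AP}}\times K_{\mathrm{AP}})$, and hence naturally induces a jointly continuous semigroup product $(s,t)\mapsto st$ on $K_{\mathrm{AP}}$, namely the one with $\Delta(F)(s,t)=F(st)$ for $F\in C(K_{\mathrm{AP}})$ and $s,t\in K_{\mathrm{AP}}$.
   Context: A commutative Hopf von Neumann algebra $(L^\infty(X),\Delta)$ is a commutative von Neumann algebra $L^\infty(X)$ with predual $L^1(X)$, together with a normal $*$-homomorphism $\Delta:L^\infty(X)\to L^\infty(X\times X)=(L^1(X)\widehat{\otimes}L^1(X))^*$ ($\widehat\otimes$ the projective tensor product) which is coassociative: $(\mathrm{id}\otimes\Delta)\Delta=(\Delta\otimes\mathrm{id})\Delta$. The pre-adjoint of $\Delta$ makes $L^1(X)$ a Banach algebra: $\langle F,ab\rangle=\langle\Delta(F),a\otimes b\rangle$ for $F\in L^\infty(X)$, $a,b\in L^1(X)$. For a Banach algebra $A$, $A^*$ is an $A$-bimodule via $\langle a\cdot\mu,b\rangle=\langle\mu,ba\rangle$, $\langle\mu\cdot a,b\rangle=\langle\mu,ab\rangle$. A functional $\mu\in A^*$ is almost periodic, written $\mu\in\mathrm{AP}(A)$, if the map $A\to A^*$, $a\mapsto a\cdot\mu$, is compact. It is known that $\mathrm{AP}(L^1(X))$ is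 a C$^*$-subalgebra of $L^\infty(X)$, and so $\mathrm{AP}(L^1(X))=C(K_{\mathrm{AP}})$ for some compact Hausdorff space $K_{\mathrm{AP}}$. Here $C(K_{\mathrm{AP}}\times K_{\mathrm{AP}})$ is identified with $\mathrm{AP}(L^1(X))\check\otimes\mathrm{AP}(L^1(X))\subseteq L^\infty(X)\check\otimes L^\infty(X)\subseteq L^\infty(X\times X)$, where $\check\otimes$ denotes the injective (= minimal C$^*$-) tensor product.
   Formalization: The coproduct Δ is assumed unital, Δ(1)=1, which the definition given does not say; without it the claim fails, e.g. for X a point and Δ=0, where AP is all of L^∞(X) but Δ(1)(s,t)=0 while 1(st)=1. *)

theory Defs
  imports "HOL-Analysis.Analysis"
begin

section \<open>Complex Banach spaces\<close>

class complex_banach = banach +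
  fixes scaleC :: "complex \<Rightarrow> 'a \<Rightarrow> 'a"  (infixr "*\<^sub>C" 75)
  assumes scaleC_add_right: "c *\<^sub>C (x + y) = c *\<^sub>C x + c *\<^sub>C y"
    and scaleC_add_left: "(c + d) *\<^sub>C x = c *\<^sub>C x + d *\<^sub>C x"
    and scaleC_scaleC: "c *\<^sub>C (d *\<^sub>C x) = (c * d) *\<^sub>C x"
    and scaleC_of_real: "complex_of_real r *\<^sub>C x = r *\<^sub>R x"
    and norm_scaleC: "norm (c *\<^sub>C x) = cmod c * norm x"

lemma bounded_linear_scaleC: "bounded_linear (\<lambda>x::'a::complex_banach. c *\<^sub>C x)"
proof (rule bounded_linear_intro)
  show "c *\<^sub>C (r *\<^sub>R x) = r *\<^sub>R (c *\<^sub>C x)" for r and x :: 'a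
    by (metis scaleC_of_real scaleC_scaleC mult.commute)
  show "norm (c *\<^sub>C x) \<le> norm x * cmod c" for x :: 'a
    by (simp add: norm_scaleC)
qed (rule scaleC_add_right)

lemma bounded_linear_scaleC_left: "bounded_linear (\<lambda>c. c *\<^sub>C (x::'a::complex_banach))"
proof (rule bounded_linear_intro)
  show "(r *\<^sub>R c) *\<^sub>C x = r *\<^sub>R (c *\<^sub>C x)" for r c
    by (metis scaleC_of_real scaleC_scaleC scaleR_conv_of_real)
  show "norm (c *\<^sub>C x) \<le> cmod c * norm x" for c
    by (simp add: norm_scaleC)
qed (rule scaleC_add_left)

instantiation complex :: complex_banach
begin
definition scaleC_complex :: "complex \<Rightarrow> complex \<Rightarrow> complex"
  where "scaleC_complex c x = c * x"
instance
  by standard (auto simp: scaleC_complex_def algebra_simps norm_mult scaleR_conv_of_real)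
end

text \<open>The library type \<open>'a \<Rightarrow>\<^sub>L 'b\<close> consists of the bounded \<^emph>\<open>real\<close>-linear maps with the operator
  norm; it is a complex Banach space with scalars acting on the values. Complex linearity
  is imposed separately, through the closed subspaces \<open>cdual\<close> and \<open>cbil\<close> below.\<close>

instantiation blinfun :: (real_normed_vector, complex_banach) complex_banach
begin
definition scaleC_blinfun :: "complex \<Rightarrow> ('a \<Rightarrow>\<^sub>L 'b) \<Rightarrow> ('a \<Rightarrow>\<^sub>L 'b)"
  where "scaleC_blinfun c f = Blinfun (\<lambda>x. c *\<^sub>C blinfun_apply f x)"

lemma blinfun_apply_scaleC [simp]: "blinfun_apply (c *\<^sub>C f) x = c *\<^sub>C blinfun_apply f x"
  for f :: "'a \<Rightarrow>\<^sub>L 'b"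
  unfolding scaleC_blinfun_def
  by (subst bounded_linear_Blinfun_apply)
     (auto intro: bounded_linear_compose[OF bounded_linear_scaleC] blinfun.bounded_linear_right)

instance
proof
  fix c d :: complex and f g :: "'a \<Rightarrow>\<^sub>L 'b" and r :: real
  show "c *\<^sub>C (f + g) = c *\<^sub>C f + c *\<^sub>C g"
    by (rule blinfun_eqI) (simp add: blinfun.add_left scaleC_add_right)
  show "(c + d) *\<^sub>C f = c *\<^sub>C f + d *\<^sub>C f"
    by (rule blinfun_eqI) (simp add: blinfun.add_left scaleC_add_left)
  show assoc: "c *\<^sub>C (d *\<^sub>C f) = (c * d) *\<^sub>C f" for c d and f :: "'a \<Rightarrow>\<^sub>L 'b"
    by (rule blinfun_eqI) (simp add: scaleC_scaleC)
  show real: "complex_of_real r *\<^sub>C f = r *\<^sub>R f" for r and f :: "'a \<Rightarrow>\<^sub>L 'b"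
    by (rule blinfun_eqI) (simp add: blinfun.scaleR_left scaleC_of_real)
  have le: "norm (c *\<^sub>C f) \<le> cmod c * norm f" for c and f :: "'a \<Rightarrow>\<^sub>L 'b"
  proof (rule norm_blinfun_bound)
    show "norm (blinfun_apply (c *\<^sub>C f) x) \<le> cmod c * norm f * norm x" for x
      using norm_blinfun[of f x] by (simp add: norm_scaleC mult.assoc mult_left_mono)
  qed simp
  show "norm (c *\<^sub>C f) = cmod c * norm f"
  proof (cases "c = 0")
    case True
    then show ?thesis using le[of 0 f] by simp
  next
    case False
    have "f = inverse c *\<^sub>C (c *\<^sub>C f)"
      using False real[of 1 f] by (simp add: assoc)
    then have "norm f \<le> inverse (cmod c) * norm (c *\<^sub>C f)"
      by (metis le norm_inverse)
    then have "cmod c * norm f \<le> norm (c *\<^sub>C f)"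
      using False by (simp add: field_simps)
    with le[of c f] show ?thesis by simp
  qed
qed
end

section \<open>The Banach spaces \<open>L\<^sup>\<infinity>(X)\<close> and \<open>L\<^sup>\<infinity>(X \<times> X)\<close>\<close>

text \<open>Throughout, the type \<open>'a\<close> plays the role of the predual \<open>L\<^sup>1(X)\<close>. The dual space \<open>L\<^sup>\<infinity>(X)\<close> is
  the set \<open>cdual\<close> of bounded complex-linear functionals. The dual of the projective tensor
  product of \<open>L\<^sup>1(X)\<close> with itself, \<open>L\<^sup>\<infinity>(X \<times> X)\<close>, is (by the universal property of the projective
  tensor product, isometrically) the set \<open>cbil\<close> of bounded complex-bilinear forms \<open>W\<close>, where
  \<open>W a b\<close> is the value of \<open>W\<close> at \<open>a \<otimes> b\<close>.\<close>

definition cdual :: "('a::complex_banach \<Rightarrow>\<^sub>L complex) set" where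
  "cdual = {F. \<forall>c a. blinfun_apply F (c *\<^sub>C a) = c * blinfun_apply F a}"

definition cbil :: "('a::complex_banach \<Rightarrow>\<^sub>L 'a \<Rightarrow>\<^sub>L complex) set" where
  "cbil = {W. \<forall>c a b. blinfun_apply (blinfun_apply W (c *\<^sub>C a)) b = c * blinfun_apply (blinfun_apply W a) b
                    \<and> blinfun_apply (blinfun_apply W a) (c *\<^sub>C b) = c * blinfun_apply (blinfun_apply W a) b}"

definition tensor ::
  "('a::complex_banach \<Rightarrow>\<^sub>L complex) \<Rightarrow> ('a \<Rightarrow>\<^sub>L complex) \<Rightarrow> ('a \<Rightarrow>\<^sub>L 'a \<Rightarrow>\<^sub>L complex)" where
  "tensor F G = Blinfun (\<lambda>a. blinfun_apply F a *\<^sub>C G)"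

lemma tensor_apply [simp]:
  "blinfun_apply (blinfun_apply (tensor F G) a) b = blinfun_apply F a * blinfun_apply G b"
  unfolding tensor_def
  by (subst bounded_linear_Blinfun_apply)
     (auto intro: bounded_linear_compose[OF bounded_linear_scaleC_left] blinfun.bounded_linear_right
           simp: scaleC_complex_def)

lemma tensor_in_cbil: "F \<in> cdual \<Longrightarrow> G \<in> cdual \<Longrightarrow> tensor F G \<in> cbil"
  by (auto simp: cdual_def cbil_def)

definition slice_left :: "('a::complex_banach \<Rightarrow>\<^sub>L 'a \<Rightarrow>\<^sub>L complex) \<Rightarrow> 'a \<Rightarrow> ('a \<Rightarrow>\<^sub>L complex)" where
  "slice_left W c = Blinfun (\<lambda>a. blinfun_apply (blinfun_apply W a) c)"

lemma slice_left_apply [simp]: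
  "blinfun_apply (slice_left W c) a = blinfun_apply (blinfun_apply W a) c"
  unfolding slice_left_def
  by (subst bounded_linear_Blinfun_apply)
     (auto intro: bounded_linear_compose[OF blinfun.bounded_linear_left] blinfun.bounded_linear_right)

text \<open>For subspaces \<open>A\<close>, \<open>B\<close> of \<open>L\<^sup>\<infinity>(X)\<close>, the injective tensor product of \<open>A\<close> and \<open>B\<close> inside
  \<open>L\<^sup>\<infinity>(X \<times> X)\<close>. The norm of a bilinear form is its supremum over the unit ball of \<open>L\<^sup>1(X)\<close> in each
  variable, which on finite sums of elementary tensors is the injective norm.\<close>

definition inj_tensor ::
  "('a::complex_banach \<Rightarrow>\<^sub>L complex) set \<Rightarrow> ('a \<Rightarrow>\<^sub>L complex) set \<Rightarrow> ('a \<Rightarrow>\<^sub>L 'a \<Rightarrow>\<^sub>L complex) set" where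
  "inj_tensor A B =
     closure {(\<Sum>i<n. tensor (F i) (G i)) | (n::nat) F G. (\<forall>i<n. F i \<in> A \<and> G i \<in> B)}"

section \<open>Commutative Hopf von Neumann algebras\<close>

locale comm_cstar_algebra =
  fixes V :: "'v::complex_banach set"
    and mul :: "'v \<Rightarrow> 'v \<Rightarrow> 'v" and star :: "'v \<Rightarrow> 'v" and one :: 'v
  assumes closed_carrier: "closed V"
    and zero_closed: "0 \<in> V"
    and add_closed: "\<lbrakk>x \<in> V; y \<in> V\<rbrakk> \<Longrightarrow> x + y \<in> V"
    and scale_closed: "x \<in> V \<Longrightarrow> c *\<^sub>C x \<in> V"
    and mult_closed: "\<lbrakk>x \<in> V; y \<in> V\<rbrakk> \<Longrightarrow> mul x y \<in> V"
    and star_closed: "x \<in> V \<Longrightarrow> star x \<in> V"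
    and one_closed: "one \<in> V"
    and mult_assoc: "\<lbrakk>x \<in> V; y \<in> V; z \<in> V\<rbrakk> \<Longrightarrow> mul (mul x y) z = mul x (mul y z)"
    and mult_comm: "\<lbrakk>x \<in> V; y \<in> V\<rbrakk> \<Longrightarrow> mul x y = mul y x"
    and one_mult: "x \<in> V \<Longrightarrow> mul one x = x"
    and mult_add: "\<lbrakk>x \<in> V; y \<in> V; z \<in> V\<rbrakk> \<Longrightarrow> mul x (y + z) = mul x y + mul x z"
    and mult_scale: "\<lbrakk>x \<in> V; y \<in> V\<rbrakk> \<Longrightarrow> mul x (c *\<^sub>C y) = c *\<^sub>C mul x y"
    and star_star: "x \<in> V \<Longrightarrow> star (star x) = x"
    and star_add: "\<lbrakk>x \<in> V; y \<in> V\<rbrakk> \<Longrightarrow> star (x + y) = star x + star y"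
    and star_scale: "x \<in> V \<Longrightarrow> star (c *\<^sub>C x) = cnj c *\<^sub>C star x"
    and star_mult: "\<lbrakk>x \<in> V; y \<in> V\<rbrakk> \<Longrightarrow> star (mul x y) = mul (star y) (star x)"
    and norm_mult_le: "\<lbrakk>x \<in> V; y \<in> V\<rbrakk> \<Longrightarrow> norm (mul x y) \<le> norm x * norm y"
    and cstar_identity: "x \<in> V \<Longrightarrow> norm (mul (star x) x) = (norm x)\<^sup>2"

definition initial_topology :: "'v set \<Rightarrow> ('v \<Rightarrow> complex) set \<Rightarrow> 'v topology" where
  "initial_topology V \<Phi> =
     topology_generated_by (insert V {{x \<in> V. \<phi> x \<in> U} | \<phi> U. \<phi> \<in> \<Phi> \<and> open U})"

definition weak_star :: "('a::complex_banach \<Rightarrow>\<^sub>L complex) topology" where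
  "weak_star = initial_topology cdual {\<lambda>F. blinfun_apply F a | a. True}"

text \<open>The elements of the projective tensor product are the sums \<open>\<Sum>n. a n \<otimes> b n\<close> with
  \<open>\<Sum>n. \<parallel>a n\<parallel> \<parallel>b n\<parallel> < \<infinity>\<close>.\<close>

definition weak_star2 :: "('a::complex_banach \<Rightarrow>\<^sub>L 'a \<Rightarrow>\<^sub>L complex) topology" where
  "weak_star2 = initial_topology cbil
     {\<lambda>W. \<Sum>n. blinfun_apply (blinfun_apply W (a n)) (b n) | a b.
        summable (\<lambda>n::nat. norm (a n) * norm (b n))}"

text \<open>A commutative von Neumann algebra with predual \<open>L\<^sup>1(X)\<close> is a commutative C*-algebra structure on
  the Banach space dual of \<open>L\<^sup>1(X)\<close>. Likewise \<open>L\<^sup>\<infinity>(X \<times> X)\<close> is the dual of the projective tensor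
  product, carrying the C*-algebra structure for which \<open>F \<otimes> G\<close> is the usual tensor; since
  multiplication and involution in a von Neumann algebra are (separately) weak*-continuous and
  the elementary tensors span a weak*-dense subspace, that structure is uniquely determined by the
  conditions on tensors below. Normality of the (unital) *-homomorphism \<open>\<Delta>\<close> is weak*-continuity.

  In \<open>coassoc\<close>, the values at \<open>a \<otimes> b \<otimes> c\<close> of \<open>(id \<otimes> \<Delta>)(W)\<close> and \<open>(\<Delta> \<otimes> id)(W)\<close>, for \<open>W\<close> in
  \<open>L\<^sup>\<infinity>(X \<times> X)\<close>, are \<open>\<Delta>(W(a,-))(b,c)\<close> and \<open>\<Delta>(W(-,c))(a,b)\<close>: both expressions are weak*-continuous
  in \<open>W\<close> and have the right values at elementary tensors.\<close>

definition id_tensor ::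
  "(('a::complex_banach \<Rightarrow>\<^sub>L complex) \<Rightarrow> ('a \<Rightarrow>\<^sub>L 'a \<Rightarrow>\<^sub>L complex)) \<Rightarrow> ('a \<Rightarrow>\<^sub>L 'a \<Rightarrow>\<^sub>L complex) \<Rightarrow> 'a \<Rightarrow> 'a \<Rightarrow> 'a \<Rightarrow> complex" where
  "id_tensor \<Delta> W a b c = blinfun_apply (blinfun_apply (\<Delta> (blinfun_apply W a)) b) c"

definition tensor_id ::
  "(('a::complex_banach \<Rightarrow>\<^sub>L complex) \<Rightarrow> ('a \<Rightarrow>\<^sub>L 'a \<Rightarrow>\<^sub>L complex)) \<Rightarrow> ('a \<Rightarrow>\<^sub>L 'a \<Rightarrow>\<^sub>L complex) \<Rightarrow> 'a \<Rightarrow> 'a \<Rightarrow> 'a \<Rightarrow> complex" where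
  "tensor_id \<Delta> W a b c = blinfun_apply (blinfun_apply (\<Delta> (slice_left W c)) a) b"

locale comm_hopf_von_neumann =
  L: comm_cstar_algebra "cdual :: ('a::complex_banach \<Rightarrow>\<^sub>L complex) set" mul star one +
  LL: comm_cstar_algebra "cbil :: ('a::complex_banach \<Rightarrow>\<^sub>L 'a::complex_banach \<Rightarrow>\<^sub>L complex) set" mul2 star2 one2
  for mul star one mul2 star2 one2 +
  fixes \<Delta> :: "('a::complex_banach \<Rightarrow>\<^sub>L complex) \<Rightarrow> ('a::complex_banach \<Rightarrow>\<^sub>L 'a::complex_banach \<Rightarrow>\<^sub>L complex)"
  assumes tensor_mult: "\<lbrakk>F \<in> cdual; G \<in> cdual; F' \<in> cdual; G' \<in> cdual\<rbrakk>
      \<Longrightarrow> mul2 (tensor F G) (tensor F' G') = tensor (mul F F') (mul G G')"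
    and tensor_star: "\<lbrakk>F \<in> cdual; G \<in> cdual\<rbrakk> \<Longrightarrow> star2 (tensor F G) = tensor (star F) (star G)"
    and tensor_one: "tensor one one = one2"
    and Delta_closed: "F \<in> cdual \<Longrightarrow> \<Delta> F \<in> cbil"
    and Delta_add: "\<lbrakk>F \<in> cdual; G \<in> cdual\<rbrakk> \<Longrightarrow> \<Delta> (F + G) = \<Delta> F + \<Delta> G"
    and Delta_scale: "F \<in> cdual \<Longrightarrow> \<Delta> (c *\<^sub>C F) = c *\<^sub>C \<Delta> F"
    and Delta_mult: "\<lbrakk>F \<in> cdual; G \<in> cdual\<rbrakk> \<Longrightarrow> \<Delta> (mul F G) = mul2 (\<Delta> F) (\<Delta> G)"
    and Delta_star: "F \<in> cdual \<Longrightarrow> \<Delta> (star F) = star2 (\<Delta> F)"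
    and Delta_one: "\<Delta> one = one2"
    and normal: "continuous_map weak_star weak_star2 \<Delta>"
    and coassoc: "F \<in> cdual \<Longrightarrow> id_tensor \<Delta> (\<Delta> F) = tensor_id \<Delta> (\<Delta> F)"

section \<open>Almost periodic functionals\<close>

text \<open>The product of \<open>L\<^sup>1(X)\<close> given by the pre-adjoint of \<open>\<Delta>\<close>. It exists when \<open>\<Delta>\<close> is normal, and it is
  unique because functionals separate points.\<close>

definition conv ::
  "(('a::complex_banach \<Rightarrow>\<^sub>L complex) \<Rightarrow> ('a \<Rightarrow>\<^sub>L 'a \<Rightarrow>\<^sub>L complex)) \<Rightarrow> 'a \<Rightarrow> 'a \<Rightarrow> 'a" where
  "conv \<Delta> a b = (SOME c. \<forall>F\<in>cdual. blinfun_apply F c = blinfun_apply (blinfun_apply (\<Delta> F) a) b)"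

definition act ::
  "(('a::complex_banach \<Rightarrow>\<^sub>L complex) \<Rightarrow> ('a \<Rightarrow>\<^sub>L 'a \<Rightarrow>\<^sub>L complex)) \<Rightarrow> 'a \<Rightarrow> ('a \<Rightarrow>\<^sub>L complex) \<Rightarrow> ('a \<Rightarrow>\<^sub>L complex)" where
  "act \<Delta> a F = Blinfun (\<lambda>b. blinfun_apply F (conv \<Delta> b a))"

definition AP ::
  "(('a::complex_banach \<Rightarrow>\<^sub>L complex) \<Rightarrow> ('a \<Rightarrow>\<^sub>L 'a \<Rightarrow>\<^sub>L complex)) \<Rightarrow> ('a \<Rightarrow>\<^sub>L complex) set" where
  "AP \<Delta> = {F \<in> cdual. compact (closure ((\<lambda>a. act \<Delta> a F) ` cball 0 1))}"

section \<open>Identification with algebras of continuous functions\<close>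

definition C_space :: "'k topology \<Rightarrow> ('k \<Rightarrow> complex) set" where
  "C_space K = {f \<in> extensional (topspace K). continuous_map K euclidean f}"

text \<open>The \<open>insert 0\<close> only matters for the empty space.\<close>

definition sup_norm :: "'k topology \<Rightarrow> ('k \<Rightarrow> complex) \<Rightarrow> real" where
  "sup_norm K f = Sup (insert 0 ((\<lambda>s. cmod (f s)) ` topspace K))"

text \<open>\<open>\<Phi>\<close> is an isometric *-isomorphism of the C*-algebra \<open>A\<close> onto \<open>C(K)\<close>.\<close>

definition iso_onto_C ::
  "'v::complex_banach set \<Rightarrow> ('v \<Rightarrow> 'v \<Rightarrow> 'v) \<Rightarrow> ('v \<Rightarrow> 'v) \<Rightarrow> 'k topology \<Rightarrow> ('v \<Rightarrow> 'k \<Rightarrow> complex) \<Rightarrow> bool" where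
  "iso_onto_C A mul star K \<Phi> \<longleftrightarrow>
     bij_betw \<Phi> A (C_space K) \<and>
     (\<forall>x\<in>A. \<forall>y\<in>A. \<forall>s\<in>topspace K. \<Phi> (x + y) s = \<Phi> x s + \<Phi> y s) \<and>
     (\<forall>c. \<forall>x\<in>A. \<forall>s\<in>topspace K. \<Phi> (c *\<^sub>C x) s = c * \<Phi> x s) \<and>
     (\<forall>x\<in>A. \<forall>y\<in>A. \<forall>s\<in>topspace K. \<Phi> (mul x y) s = \<Phi> x s * \<Phi> y s) \<and>
     (\<forall>x\<in>A. \<forall>s\<in>topspace K. \<Phi> (star x) s = cnj (\<Phi> x s)) \<and>
     (\<forall>x\<in>A. sup_norm K (\<Phi> x) = norm x)"

end

theory Submission
  imports Defs
begin

text \<open>A functional \<open>F\<close> is almost periodic iff \<open>\<Delta> F\<close>, viewed as an operator from \<open>L\<^sup>1(X)\<close> to \<open>L\<^sup>\<infinity>(X)\<close>, is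
  compact, and by coassociativity all slices of \<open>\<Delta> F\<close> are then almost periodic again. Since
  \<open>AP\<close> is isometric to \<open>C(K)\<close>, a partition of unity on \<open>K\<close> together with elements of
  \<open>L\<^sup>1(X)\<close> approximating finitely many point evaluations turns the compact operator \<open>\<Delta> F\<close> into a
  limit of finite sums of elementary tensors of its slices, so \<open>\<Delta> F\<close> lies in the injective tensor
  product. This argument does not use products in \<open>AP\<close>; conversely it yields that \<open>AP\<close> is an algebra,
  because the closed span of the elementary tensors is an algebra of compact operators. The composition of \<open>\<Delta>\<close>
  with the evaluation at \<open>(s, t)\<close> is a character of \<open>C(K)\<close>, hence evaluation at a point \<open>st\<close>.\<close>

section \<open>Boundedness of the coproduct\<close>

text \<open>A point of \<open>K\<close> need not come from an element of L^1(X), and this shapes the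
  proof twice. On a totally bounded subset of C(K), mapping f to the sum of the f(p)
  \<open>\<phi> p\<close> over a partition of unity is almost the identity. For f =
  \<open>\<Phi> (\<Delta> F a)\<close> the coefficient f(p), as a functional of a, is not yet known
  to be almost periodic. Replacing the point p by an element b of L^1(X) turns it into a left slice
  of \<open>\<Delta> F\<close>, which is almost periodic by coassociativity. Only when
  \<open>\<Delta> F\<close> is known to lie in the tensor product may its second variable be
  evaluated at a genuine point and \<open>\<Phi>\<close> be applied to the result; this yields
  \<open>\<Theta>\<close>. Associativity meets the same obstacle: coassociativity concerns three
  elements of L^1(X), so a point of \<open>K\<close> can enter only after it has been read as an
  equality of functionals in the third variable. Throughout, compactness survives slicing and norm
  limits because \<open>\<Delta>\<close> is bounded, which is extracted from normality by way of the
  predual.\<close>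

text \<open>Banach-Steinhaus by Baire category: one of the closed sets \<open>S n\<close> contains a
  ball, and differences of its points bound every \<open>T i\<close> near 0. The codomain is a
  general normed space because \<open>Delta_bounded\<close> applies the result once for each
  variable of a bilinear form.\<close>

lemma uniform_boundedness:
  fixes T :: "'i \<Rightarrow> ('a::banach \<Rightarrow>\<^sub>L 'b::real_normed_vector)"
  assumes "\<And>x. \<exists>C. \<forall>i\<in>I. norm (T i x) \<le> C"
  shows "\<exists>C. \<forall>i\<in>I. norm (T i) \<le> C"
proof -
  define S where "S n = {x. \<forall>i\<in>I. norm (T i x) \<le> real n}" for n
  have clS: "closed (S n)" for n
  proof -
    have "S n = (\<Inter>i\<in>I. {x. norm (T i x) \<le> real n})"
      by (auto simp: S_def)
    moreover have "closed {x. norm (T i x) \<le> real n}" for i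
      by (intro closed_Collect_le continuous_intros linear_continuous_on blinfun.bounded_linear_right)
    ultimately show ?thesis by auto
  qed
  have cover: "(\<Union>n. S n) = UNIV"
  proof -
    have "\<exists>n. x \<in> S n" for x
    proof -
      obtain C where "\<forall>i\<in>I. norm (T i x) \<le> C" using assms by blast
      moreover obtain n where "C \<le> real n" using real_arch_simple by blast
      ultimately have "x \<in> S n" unfolding S_def mem_Collect_eq by (meson order_trans)
      then show ?thesis ..
    qed
    then show ?thesis by auto
  qed
  have "\<exists>n. interior (S n) \<noteq> {}"
  proof (rule ccontr)
    assume "\<not> ?thesis"
    then have "Met_TC.mtopology interior_of \<Union>(range S) = {}"
      by (intro Met_TC.metric_Baire_category_alt) (auto simp: complete_UNIV clS)
    then show False by (simp add: cover)
  qed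
  then obtain n x0 where "x0 \<in> interior (S n)" by blast
  then obtain r where r: "r > 0" "cball x0 r \<subseteq> S n"
    by (meson mem_interior_cball)
  have "norm (T i) \<le> 2 * real n / r" if i: "i \<in> I" for i
  proof (rule norm_blinfun_bound)
    fix x :: 'a
    show "norm (T i x) \<le> 2 * real n / r * norm x"
    proof (cases "x = 0")
      case False
      define y where "y = (r / norm x) *\<^sub>R x"
      have "norm y = r" using False r by (simp add: y_def)
      then have "x0 + y \<in> S n" "x0 \<in> S n" using r by (auto simp: dist_norm)
      then have "norm (T i (x0 + y)) \<le> n" "norm (T i x0) \<le> n" using i by (auto simp: S_def)
      then have "norm (T i y) \<le> 2 * n"
        using norm_triangle_ineq4[of "T i (x0 + y)" "T i x0"] by (simp add: blinfun.add_right)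
      then show ?thesis using False r by (simp add: y_def blinfun.scaleR_right field_simps)
    qed simp
  qed (use r in auto)
  then show ?thesis by blast
qed

lemma scaleC_0_left [simp]: "0 *\<^sub>C x = (0::'a::complex_banach)"
  using norm_scaleC[of 0 x] by simp

lemma scaleC_0_right [simp]: "c *\<^sub>C 0 = (0::'a::complex_banach)"
  using norm_scaleC[of c "0::'a"] by simp

lemma scaleC_minus_one: "(-1) *\<^sub>C x = - (x::'a::complex_banach)"
  using scaleC_of_real[of "-1" x] by simp

lemma scaleC_diff_right: "c *\<^sub>C (x - y) = c *\<^sub>C x - c *\<^sub>C (y::'a::complex_banach)"
  by (rule linear_diff[OF bounded_linear.linear[OF bounded_linear_scaleC]])

lemma scaleC_complex [simp]: "c *\<^sub>C (z::complex) = c * z"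
  by (simp add: scaleC_complex_def)

lemma cdual_scaleC: "F \<in> cdual \<Longrightarrow> F (c *\<^sub>C a) = c * F a"
  by (simp add: cdual_def)

lemma subspace_cdual:
  shows cdual_0: "0 \<in> cdual"
    and cdual_add: "F \<in> cdual \<Longrightarrow> G \<in> cdual \<Longrightarrow> F + G \<in> cdual"
    and cdual_scale: "F \<in> cdual \<Longrightarrow> c *\<^sub>C F \<in> cdual"
    and cdual_diff: "F \<in> cdual \<Longrightarrow> G \<in> cdual \<Longrightarrow> F - G \<in> cdual"
  by (auto simp: cdual_def blinfun.add_left blinfun.diff_left algebra_simps)

lemma cbil_right: "W \<in> cbil \<Longrightarrow> W a \<in> cdual"
  by (auto simp: cbil_def cdual_def)

lemma cbil_slice_left: "W \<in> cbil \<Longrightarrow> slice_left W a \<in> cdual"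
  by (auto simp: cbil_def cdual_def)

lemma subspace_cbil:
  shows cbil_0: "0 \<in> cbil"
    and cbil_add: "V \<in> cbil \<Longrightarrow> W \<in> cbil \<Longrightarrow> V + W \<in> cbil"
    and cbil_diff: "V \<in> cbil \<Longrightarrow> W \<in> cbil \<Longrightarrow> V - W \<in> cbil"
  by (auto simp: cbil_def blinfun.add_left blinfun.diff_left algebra_simps)

lemma closed_cbil: "closed (cbil :: ('a::complex_banach \<Rightarrow>\<^sub>L 'a \<Rightarrow>\<^sub>L complex) set)"
proof -
  have cont: "continuous_on UNIV (\<lambda>W::'a \<Rightarrow>\<^sub>L 'a \<Rightarrow>\<^sub>L complex. W a b)" for a b
    by (intro linear_continuous_on bounded_linear_compose[OF blinfun.bounded_linear_left]
        blinfun.bounded_linear_left)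
  have eq: "cbil = (\<Inter>c a b. {W::'a \<Rightarrow>\<^sub>L 'a \<Rightarrow>\<^sub>L complex. W (c *\<^sub>C a) b = c * W a b} \<inter> {W::'a \<Rightarrow>\<^sub>L 'a \<Rightarrow>\<^sub>L complex. W a (c *\<^sub>C b) = c * W a b})"
    by (auto simp: cbil_def)
  have "closed {W::'a \<Rightarrow>\<^sub>L 'a \<Rightarrow>\<^sub>L complex. W (c *\<^sub>C a) b = c * W a b}"
                "closed {W::'a \<Rightarrow>\<^sub>L 'a \<Rightarrow>\<^sub>L complex. W a (c *\<^sub>C b) = c * W a b}" for c a b
    by (intro closed_Collect_eq continuous_intros cont)+
  then show ?thesis unfolding eq by (intro closed_INT closed_Int ballI)
qed

lemma norm_bilinear: "norm (W a b) \<le> norm W * norm a * norm b"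
  for W :: "'a::real_normed_vector \<Rightarrow>\<^sub>L 'b::real_normed_vector \<Rightarrow>\<^sub>L 'c::real_normed_vector"
  by (meson mult_right_mono norm_blinfun norm_ge_zero order_trans)

lemma norm_slice_left_le: "norm (slice_left W b) \<le> norm W * norm b"
  by (rule norm_blinfun_bound) (use norm_bilinear[of W _ b] in \<open>auto simp: mult_ac\<close>)

lemma norm_le_unit_ball:
  fixes f :: "'a::real_normed_vector \<Rightarrow>\<^sub>L 'b::real_normed_vector"
  assumes "\<And>a. norm a \<le> 1 \<Longrightarrow> norm (f a) \<le> c" and "0 \<le> c"
  shows "norm f \<le> c"
proof (rule norm_blinfun_bound[OF \<open>0 \<le> c\<close>])
  fix x :: 'a
  show "norm (f x) \<le> c * norm x"
  proof (cases "x = 0")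
    case False
    then show ?thesis using assms(1)[of "(1 / norm x) *\<^sub>R x"]
      by (simp add: blinfun.scaleR_right field_simps)
  qed simp
qed

lemma norm_le_unit_ball_apply:
  fixes f :: "'a::real_normed_vector \<Rightarrow>\<^sub>L 'b::real_normed_vector"
  assumes "norm a \<le> 1" shows "norm (f a) \<le> norm f"
  using norm_blinfun[of f a] mult_left_mono[OF assms norm_ge_zero[of f]] by simp

section \<open>Normality and the pre-adjoint product on L^1(X)\<close>

text \<open>A functional that vanishes on the common kernel of finitely many evaluations is a linear
  combination of them, hence itself evaluation at one element of the predual.\<close>

lemma evaluation_of_kernel:
  fixes X :: "'a::complex_banach set" and \<l> :: "('a \<Rightarrow>\<^sub>L complex) \<Rightarrow> complex"
  assumes "finite X"
    and "\<And>F G. F \<in> cdual \<Longrightarrow> G \<in> cdual \<Longrightarrow> \<l> (F + G) = \<l> F + \<l> G"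
    and "\<And>c F. F \<in> cdual \<Longrightarrow> \<l> (c *\<^sub>C F) = c * \<l> F"
    and "\<And>F. F \<in> cdual \<Longrightarrow> \<forall>x\<in>X. F x = 0 \<Longrightarrow> \<l> F = 0"
  shows "\<exists>y. \<forall>F\<in>cdual. \<l> F = F y"
  using assms
proof (induction X arbitrary: \<l> rule: finite_induct)
  case empty
  then show ?case by (intro exI[of _ 0]) simp
next
  case (insert x X)
  show ?case
  proof (cases "\<forall>F\<in>cdual. (\<forall>z\<in>X. F z = 0) \<longrightarrow> F x = 0")
    case True
    then show ?thesis using insert.prems by (intro insert.IH) auto
  next
    case False
    then obtain F1 where F1: "F1 \<in> cdual" "\<forall>z\<in>X. F1 z = 0" "F1 x \<noteq> 0" by blast
    \<comment> \<open>\<open>F0\<close> vanishes on \<open>X\<close> and is 1 at \<open>x\<close>.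
      Subtracting \<open>\<l> F0\<close> times the evaluation at \<open>x\<close> leaves a
      functional that vanishes on the common kernel of \<open>X\<close> alone.\<close>
    define F0 where "F0 = inverse (F1 x) *\<^sub>C F1"
    have F0: "F0 \<in> cdual" "\<forall>z\<in>X. F0 z = 0" "F0 x = 1"
      using F1 by (auto simp: F0_def cdual_scale)
    define \<l>' where "\<l>' F = \<l> F - \<l> F0 * F x" for F
    have "\<exists>y. \<forall>F\<in>cdual. \<l>' F = F y"
    proof (rule insert.IH)
      fix F G :: "'a \<Rightarrow>\<^sub>L complex" assume "F \<in> cdual" "G \<in> cdual"
      then show "\<l>' (F + G) = \<l>' F + \<l>' G"
        using insert.prems(1)[of F G] by (simp add: \<l>'_def blinfun.add_left algebra_simps)
    next
      fix c and F :: "'a \<Rightarrow>\<^sub>L complex" assume "F \<in> cdual"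
      then show "\<l>' (c *\<^sub>C F) = c * \<l>' F"
        using insert.prems(2)[of F c] by (simp add: \<l>'_def algebra_simps)
    next
      fix F :: "'a \<Rightarrow>\<^sub>L complex" assume F: "F \<in> cdual" "\<forall>x\<in>X. F x = 0"
      define G where "G = F + (- F x) *\<^sub>C F0"
      have "G \<in> cdual" using F F0 by (auto simp: G_def intro: cdual_add cdual_scale)
      moreover have "\<forall>z\<in>insert x X. G z = 0" using F F0 by (auto simp: G_def blinfun.add_left)
      ultimately have "\<l> G = 0" using insert.prems(3) by blast
      moreover have "\<l> G = \<l> F + (- F x) * \<l> F0"
        using F F0 insert.prems(1,2) by (simp add: G_def cdual_scale)
      ultimately show "\<l>' F = 0" by (simp add: \<l>'_def)
    qed
    then obtain y where y: "\<forall>F\<in>cdual. \<l>' F = F y" by blast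
    show ?thesis
    proof (intro exI ballI)
      fix F :: "'a \<Rightarrow>\<^sub>L complex" assume F: "F \<in> cdual"
      then have "\<l> F - \<l> F0 * F x = F y" using y by (simp add: \<l>'_def)
      then show "\<l> F = F (y + \<l> F0 *\<^sub>C x)"
        using F by (simp add: cdual_scaleC blinfun.add_right algebra_simps)
    qed
  qed
qed

text \<open>Reduces weak* continuity at 0 to finitely many elements of the predual, by induction on
  how the open set is generated.\<close>

lemma weak_star_nbhd_0:
  fixes U :: "('a::complex_banach \<Rightarrow>\<^sub>L complex) set"
  assumes "openin weak_star U" "0 \<in> U"
  shows "\<exists>X d. finite X \<and> d > 0 \<and> {F \<in> cdual. \<forall>x\<in>X. cmod (F x) < d} \<subseteq> U"
proof -
  have "generate_topology_on
      (insert cdual {{x \<in> cdual. \<phi> x \<in> U} | \<phi> U. \<phi> \<in> {\<lambda>F::'a \<Rightarrow>\<^sub>L complex. F a | a. True} \<and> open U}) U"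
    using assms(1) unfolding weak_star_def initial_topology_def openin_topology_generated_by_iff .
  then show ?thesis using assms(2)
  proof (induction rule: generate_topology_on.induct)
    case (Int A B)
    then obtain X d Y e where *: "finite X" "d > 0" "{F \<in> cdual. \<forall>x\<in>X. cmod (F x) < d} \<subseteq> A"
      "finite Y" "e > 0" "{F \<in> cdual. \<forall>x\<in>Y. cmod (F x) < e} \<subseteq> B" by auto
    show ?case
      by (rule exI[of _ "X \<union> Y"], rule exI[of _ "min d e"]) (use * in auto)
  next
    case (UN \<K>)
    then show ?case by (meson Union_iff Sup_upper order_trans)
  next
    case (Basis s)
    then consider "s = cdual" | a V where "s = {F \<in> cdual. blinfun_apply F a \<in> V}" "open V"
      by blast
    then show ?case
    proof cases
      case 1
      then show ?thesis by (intro exI[of _ "{}"] exI[of _ 1]) auto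
    next
      case 2
      then obtain d where "d > 0" "ball 0 d \<subseteq> V"
        using Basis by (auto simp: open_contains_ball)
      then show ?thesis using 2 by (intro exI[of _ "{a}"] exI[of _ d]) (auto simp: subset_iff)
    qed
  qed simp
qed

lemma openin_weak_star2_evaluation:
  fixes a b :: "'a::complex_banach"
  assumes "open U"
  shows "openin weak_star2 {W \<in> cbil. blinfun_apply (blinfun_apply W a) b \<in> U}"
proof -
  \<comment> \<open>The functionals generating the topology are series of elementary tensors; a
    single tensor is the series supported at index 0.\<close>
  define a' b' where "a' = (\<lambda>n::nat. if n = 0 then a else 0)" and "b' = (\<lambda>n::nat. if n = 0 then b else 0)"
  have "(\<Sum>n. blinfun_apply (blinfun_apply W (a' n)) (b' n)) = W a b" for W :: "'a \<Rightarrow>\<^sub>L 'a \<Rightarrow>\<^sub>L complex" 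
    by (subst suminf_finite[of "{0}"]) (auto simp: a'_def b'_def)
  then have eq: "(\<lambda>W. blinfun_apply (blinfun_apply W a) b)
      = (\<lambda>W. \<Sum>n. blinfun_apply (blinfun_apply W (a' n)) (b' n :: 'a) :: complex)"
    by (intro ext) simp
  have "summable (\<lambda>n. norm (a' n) * norm (b' n))"
    by (rule summable_finite[of "{0}"]) (auto simp: a'_def)
  then have mem: "(\<lambda>W. blinfun_apply (blinfun_apply W a) b) \<in> {\<lambda>W::'a \<Rightarrow>\<^sub>L 'a \<Rightarrow>\<^sub>L complex.
      \<Sum>n. blinfun_apply (blinfun_apply W (a n)) (b n) | a b. summable (\<lambda>n::nat. norm (a n) * norm (b n))}"
    unfolding eq by blast
  show ?thesis
    unfolding weak_star2_def initial_topology_def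
    by (intro topology_generated_by_Basis insertI2 CollectI exI[of _ U] conjI assms refl mem
        exI[of _ "\<lambda>W. blinfun_apply (blinfun_apply W a) b"])
qed

context comm_hopf_von_neumann
begin

text \<open>\<open>conv\<close> is a choice, so existence has to be shown. By normality the map
  \<open>F \<mapsto> \<Delta> F a b\<close> is weak* continuous at 0, so it vanishes on the common
  kernel of finitely many evaluations and is itself an evaluation.\<close>

lemma conv_apply:
  assumes "F \<in> cdual"
  shows "F (conv \<Delta> a b) = \<Delta> F a b"
proof -
  have "\<exists>c. \<forall>F\<in>cdual. \<Delta> F a b = blinfun_apply F c"
  proof -
    define U where "U = {F \<in> topspace weak_star. \<Delta> F \<in> {W \<in> cbil. W a b \<in> ball 0 1}}"
    have top: "topspace (weak_star :: ('a \<Rightarrow>\<^sub>L complex) topology) = cdual"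
      by (auto simp: weak_star_def initial_topology_def)
    have 0: "\<Delta> 0 = 0"
      using Delta_scale[OF cdual_0, of 0] by simp
    have "openin weak_star U"
      unfolding U_def
      by (rule openin_continuous_map_preimage[OF normal openin_weak_star2_evaluation]) simp
    moreover have "0 \<in> U" by (simp add: U_def top cdual_0 0 cbil_0)
    ultimately obtain X d where X: "finite X" "d > 0" "{F \<in> cdual. \<forall>x\<in>X. cmod (F x) < d} \<subseteq> U"
      using weak_star_nbhd_0[of U] by auto
    show ?thesis
    proof (rule evaluation_of_kernel[OF \<open>finite X\<close>])
      fix F :: "'a \<Rightarrow>\<^sub>L complex" assume F: "F \<in> cdual" "\<forall>x\<in>X. F x = 0"
      show "\<Delta> F a b = 0"
      proof (rule ccontr)
        assume ne: "\<Delta> F a b \<noteq> 0"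
        \<comment> \<open>The common kernel is a subspace, so every multiple of \<open>F\<close>
          stays in \<open>U\<close>; this multiple would take the value exactly 1.\<close>
        define c where "c = inverse (\<Delta> F a b)"
        have "c *\<^sub>C F \<in> U" using X F by (auto simp: cdual_scale subset_iff)
        then have "cmod (\<Delta> (c *\<^sub>C F) a b) < 1" by (simp add: U_def)
        then show False using ne by (simp add: Delta_scale[OF F(1)] c_def)
      qed
    qed (auto simp: Delta_add Delta_scale blinfun.add_left)
  qed
  then have "\<exists>c. \<forall>F\<in>cdual. blinfun_apply F c = \<Delta> F a b" by (simp add: eq_commute)
  then have "\<forall>F\<in>cdual. blinfun_apply F (conv \<Delta> a b) = \<Delta> F a b"
    unfolding conv_def by (rule someI_ex)
  then show ?thesis using assms by blast
qed

lemma act_eq: "F \<in> cdual \<Longrightarrow> act \<Delta> a F = slice_left (\<Delta> F) a"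
  unfolding act_def slice_left_def by (simp add: conv_apply)

lemma Delta_0: "\<Delta> 0 = 0"
  using Delta_scale[OF cdual_0, of 0] by simp

lemma Delta_diff: "F \<in> cdual \<Longrightarrow> G \<in> cdual \<Longrightarrow> \<Delta> (F - G) = \<Delta> F - \<Delta> G"
  using Delta_add[of "F - G" G] by (simp add: cdual_diff)

text \<open>Through the predual, \<open>norm (conv \<Delta> a b)\<close> bounds
  \<open>\<Delta> F a b\<close> on the unit ball; uniform boundedness in \<open>b\<close> and then
  in \<open>a\<close> turns this into an operator bound. The size of the constant is immaterial
  below.\<close>

lemma Delta_bounded: "\<exists>C>0. \<forall>F\<in>cdual. norm (\<Delta> F) \<le> C * norm F"
proof -
  define I :: "('a \<Rightarrow>\<^sub>L complex) set" where "I = {F \<in> cdual. norm F \<le> 1}"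
  have "\<exists>C. \<forall>F\<in>I. norm (\<Delta> F a b) \<le> C" for a b
  proof (intro exI ballI)
    fix F assume F: "F \<in> I"
    have "norm (F (conv \<Delta> a b)) \<le> norm F * norm (conv \<Delta> a b)" by (rule norm_blinfun)
    also have "\<dots> \<le> 1 * norm (conv \<Delta> a b)" using F by (intro mult_right_mono) (auto simp: I_def)
    finally show "norm (\<Delta> F a b) \<le> norm (conv \<Delta> a b)"
      using F by (simp add: conv_apply I_def)
  qed
  then have "\<exists>C. \<forall>F\<in>I. norm (\<Delta> F a) \<le> C" for a
    by (rule uniform_boundedness)
  then have "\<exists>C. \<forall>F\<in>I. norm (\<Delta> F) \<le> C"
    by (rule uniform_boundedness)
  then obtain C where C: "\<And>F. F \<in> I \<Longrightarrow> norm (\<Delta> F) \<le> C" by blast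
  have "norm (\<Delta> F) \<le> (\<bar>C\<bar> + 1) * norm F" if F: "F \<in> cdual" for F
  proof (cases "F = 0")
    case False
    define c where "c = complex_of_real (1 / norm F)"
    have "c *\<^sub>C F \<in> I" using F False by (simp add: I_def cdual_scale norm_scaleC c_def norm_divide)
    from C[OF this] have "norm (\<Delta> F) / norm F \<le> C"
      by (simp add: Delta_scale[OF F] norm_scaleC c_def norm_divide)
    then have "norm (\<Delta> F) \<le> C * norm F" using False by (simp add: field_simps)
    also have "\<dots> \<le> (\<bar>C\<bar> + 1) * norm F" by (intro mult_right_mono) auto
    finally show ?thesis .
  qed (simp add: Delta_0)
  then show ?thesis by (intro exI[of _ "\<bar>C\<bar> + 1"]) auto
qed

end

section \<open>Compact operators and almost periodic functionals\<close>

text \<open>Total boundedness of the image of the unit ball, with the centres indexed by points of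
  the ball itself. The same finite set can then serve another function with values in another space,
  and the notion applies to plain functions such as \<open>slice_left W\<close>.\<close>

definition compact_op :: "('a::real_normed_vector \<Rightarrow> 'b::metric_space) \<Rightarrow> bool" where
  "compact_op f \<longleftrightarrow> (\<forall>e>0. \<exists>X. finite X \<and> X \<subseteq> cball 0 1 \<and> (\<forall>a\<in>cball 0 1. \<exists>x\<in>X. dist (f a) (f x) < e))"

lemma compact_opD:
  assumes "compact_op f" "0 < e"
  obtains X where "finite X" "\<And>x. x \<in> X \<Longrightarrow> norm x \<le> 1"
    "\<And>a. norm a \<le> 1 \<Longrightarrow> \<exists>x\<in>X. dist (f a) (f x) < e"
proof -
  obtain X where "finite X" "X \<subseteq> cball 0 1" "\<forall>a\<in>cball 0 1. \<exists>x\<in>X. dist (f a) (f x) < e"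
    using assms(1)[unfolded compact_op_def, THEN spec, THEN mp, OF assms(2)] by (elim exE conjE)
  then show ?thesis by (intro that[of X]) (auto simp: subset_iff)
qed

lemma compact_opI:
  assumes "\<And>e. 0 < e \<Longrightarrow> \<exists>X. finite X \<and> (\<forall>x\<in>X. norm x \<le> 1) \<and>
      (\<forall>a. norm a \<le> 1 \<longrightarrow> (\<exists>x\<in>X. dist (f a) (f x) < e))"
  shows "compact_op f"
  unfolding compact_op_def
proof (intro allI impI)
  fix e :: real assume "0 < e"
  from assms[OF this] obtain X where "finite X" "\<forall>x\<in>X. norm x \<le> 1" "\<forall>a. norm a \<le> 1 \<longrightarrow> (\<exists>x\<in>X. dist (f a) (f x) < e)"
    by (elim exE conjE)
  then show "\<exists>X. finite X \<and> X \<subseteq> cball 0 1 \<and> (\<forall>a\<in>cball 0 1. \<exists>x\<in>X. dist (f a) (f x) < e)"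
    by (intro exI[of _ X]) auto
qed

lemma compact_op_iff_compact_closure:
  fixes f :: "'a::real_normed_vector \<Rightarrow> 'b::banach"
  shows "compact_op f \<longleftrightarrow> compact (closure (f ` cball 0 1))"
proof
  assume f: "compact_op f"
  show "compact (closure (f ` cball 0 1))"
    unfolding compact_eq_totally_bounded
  proof (intro conjI allI impI)
    show "complete (closure (f ` cball 0 1))" by (simp add: complete_eq_closed)
    fix e :: real assume "0 < e"
    then obtain X where X: "finite X" "\<And>a. norm a \<le> 1 \<Longrightarrow> \<exists>x\<in>X. dist (f a) (f x) < e / 2"
      using compact_opD[OF f, of "e / 2"] by (metis half_gt_zero)
    have "closure (f ` cball 0 1) \<subseteq> (\<Union>x\<in>f ` X. ball x e)"
    proof
      fix y assume "y \<in> closure (f ` cball 0 1)"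
      then obtain a where a: "norm a \<le> 1" "dist (f a) y < e / 2"
        using \<open>0 < e\<close> unfolding closure_approachable by (metis half_gt_zero imageE mem_cball_0)
      then obtain x where "x \<in> X" "dist (f a) (f x) < e / 2" using X by blast
      with a have "dist (f x) y < e" by (metis dist_triangle_half_r)
      then show "y \<in> (\<Union>x\<in>f ` X. ball x e)" using \<open>x \<in> X\<close> by auto
    qed
    then show "\<exists>k. finite k \<and> closure (f ` cball 0 1) \<subseteq> (\<Union>x\<in>k. ball x e)"
      using X(1) by blast
  qed
next
  assume c: "compact (closure (f ` cball 0 1))"
  show "compact_op f"
  proof (rule compact_opI)
    fix e :: real assume "0 < e"
    \<comment> \<open>Balls centred at points of the image already cover its closure, which is what
      places the net inside the ball.\<close>
    have "closure (f ` cball 0 1) \<subseteq> (\<Union>a\<in>cball 0 1. ball (f a) e)"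
      using \<open>0 < e\<close> by (force simp: closure_approachable)
    then obtain X where X: "finite X" "X \<subseteq> cball 0 1" "closure (f ` cball 0 1) \<subseteq> (\<Union>a\<in>X. ball (f a) e)"
      using compactE_image[OF c] by (metis open_ball)
    have "\<exists>x\<in>X. dist (f a) (f x) < e" if "norm a \<le> 1" for a
    proof -
      have "f a \<in> closure (f ` cball 0 1)"
        using that closure_subset[of "f ` cball 0 1"] by auto
      then obtain x where "x \<in> X" "f a \<in> ball (f x) e" using X(3) by blast
      then show ?thesis by (auto simp: dist_commute)
    qed
    then show "\<exists>X. finite X \<and> (\<forall>x\<in>X. norm x \<le> 1) \<and>
        (\<forall>a. norm a \<le> 1 \<longrightarrow> (\<exists>x\<in>X. dist (f a) (f x) < e))"
      using X by (intro exI[of _ X]) (auto simp: subset_iff)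
  qed
qed

lemma compact_op_subset_compact:
  fixes f :: "'a::real_normed_vector \<Rightarrow> 'b::banach"
  assumes "compact C" "\<And>a. norm a \<le> 1 \<Longrightarrow> f a \<in> C"
  shows "compact_op f"
proof -
  have "closure (f ` cball 0 1) \<subseteq> C"
    using assms by (intro closure_minimal) (auto simp: compact_imp_closed)
  then have "compact (closure (f ` cball 0 1))"
    using assms(1) by (metis closed_closure compact_Int_closed inf.absorb2)
  then show ?thesis by (simp add: compact_op_iff_compact_closure)
qed

lemma compact_op_add:
  fixes f g :: "'a::real_normed_vector \<Rightarrow> 'b::banach"
  assumes "compact_op f" "compact_op g"
  shows "compact_op (\<lambda>a. f a + g a)"
proof (rule compact_op_subset_compact[OF compact_sums])
  show "compact (closure (f ` cball 0 1))" "compact (closure (g ` cball 0 1))"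
    using assms by (simp_all add: compact_op_iff_compact_closure)
  fix a :: 'a assume "norm a \<le> 1"
  then have "f a \<in> closure (f ` cball 0 1)" "g a \<in> closure (g ` cball 0 1)"
    using closure_subset by fastforce+
  then show "f a + g a \<in> {x + y |x y. x \<in> closure (f ` cball 0 1) \<and> y \<in> closure (g ` cball 0 1)}"
    by blast
qed

text \<open>A net for \<open>f\<close> is also one for \<open>g\<close> after rescaling the radius.
  This is the form in which a compact map followed by a bounded one is seen to be compact.\<close>

lemma compact_op_lipschitz:
  assumes f: "compact_op f" and "\<And>a b. norm a \<le> 1 \<Longrightarrow> norm b \<le> 1 \<Longrightarrow> dist (g a) (g b) \<le> C * dist (f a) (f b)"
  shows "compact_op g"
proof (rule compact_opI)
  fix e :: real assume e: "0 < e"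
  obtain X where X: "finite X" "\<And>x. x \<in> X \<Longrightarrow> norm x \<le> 1"
    "\<And>a. norm a \<le> 1 \<Longrightarrow> \<exists>x\<in>X. dist (f a) (f x) < e / (\<bar>C\<bar> + 1)"
    by (rule compact_opD[OF f, of "e / (\<bar>C\<bar> + 1)"]) (use e in \<open>auto intro!: divide_pos_pos\<close>)
  have "\<exists>x\<in>X. dist (g a) (g x) < e" if a: "norm a \<le> 1" for a
  proof -
    obtain x where x: "x \<in> X" "dist (f a) (f x) < e / (\<bar>C\<bar> + 1)" using X a by blast
    have "dist (g a) (g x) \<le> C * dist (f a) (f x)" using assms(2) a X x by blast
    also have "\<dots> \<le> (\<bar>C\<bar> + 1) * dist (f a) (f x)" by (intro mult_right_mono) auto
    also have "\<dots> < e" using x(2) by (simp add: field_simps)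
    finally show ?thesis using x by blast
  qed
  then show "\<exists>X. finite X \<and> (\<forall>x\<in>X. norm x \<le> 1) \<and>
      (\<forall>a. norm a \<le> 1 \<longrightarrow> (\<exists>x\<in>X. dist (g a) (g x) < e))"
    using X by blast
qed

lemma compact_op_uniform_limit:
  assumes "\<And>e. 0 < e \<Longrightarrow> \<exists>g. compact_op g \<and> (\<forall>a. norm a \<le> 1 \<longrightarrow> dist (f a) (g a) < e)"
  shows "compact_op f"
proof (rule compact_opI)
  fix e :: real assume e: "0 < e"
  then obtain g where g: "compact_op g" "\<And>a. norm a \<le> 1 \<Longrightarrow> dist (f a) (g a) < e / 3"
    using assms[of "e / 3"] by auto
  obtain X where X: "finite X" "\<And>x. x \<in> X \<Longrightarrow> norm x \<le> 1"
    "\<And>a. norm a \<le> 1 \<Longrightarrow> \<exists>x\<in>X. dist (g a) (g x) < e / 3"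
    using compact_opD[OF g(1), of "e / 3"] e by auto
  have "\<exists>x\<in>X. dist (f a) (f x) < e" if a: "norm a \<le> 1" for a
  proof -
    obtain x where x: "x \<in> X" "dist (g a) (g x) < e / 3" using X a by blast
    have "dist (f x) (g x) < e / 3" "dist (f a) (g a) < e / 3" using g a X x by auto
    then have "dist (f a) (f x) < e" using x(2) by metric
    then show ?thesis using x by blast
  qed
  then show "\<exists>X. finite X \<and> (\<forall>x\<in>X. norm x \<le> 1) \<and>
      (\<forall>a. norm a \<le> 1 \<longrightarrow> (\<exists>x\<in>X. dist (f a) (f x) < e))"
    using X by blast
qed

text \<open>Each \<open>a\<close> is coded by net points of the disc near its values on
  \<open>X\<close>. There are finitely many codes, and one representative of each suffices.\<close>

lemma finite_net_bounded_functions: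
  fixes f :: "'x \<Rightarrow> 'a \<Rightarrow> complex"
  assumes "finite X" and bdd: "\<And>x a. x \<in> X \<Longrightarrow> a \<in> Y \<Longrightarrow> cmod (f x a) \<le> C" and "0 < e"
  shows "\<exists>Z. finite Z \<and> Z \<subseteq> Y \<and> (\<forall>a\<in>Y. \<exists>z\<in>Z. \<forall>x\<in>X. cmod (f x a - f x z) < e)"
proof -
  have "\<exists>N. finite N \<and> cball (0::complex) C \<subseteq> (\<Union>c\<in>N. ball c (e / 2))"
    by (rule compact_cball[of "0::complex" C, unfolded compact_eq_totally_bounded, THEN conjunct2,
        THEN spec, THEN mp, OF half_gt_zero[OF \<open>0 < e\<close>]])
  then obtain N where N: "finite N" "cball (0::complex) C \<subseteq> (\<Union>c\<in>N. ball c (e / 2))"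
    by (elim exE conjE)
  have "\<exists>k. \<forall>x\<in>X. k x \<in> N \<and> dist (k x) (f x a) < e / 2" if "a \<in> Y" for a
  proof -
    have "\<forall>x\<in>X. \<exists>c. c \<in> N \<and> dist c (f x a) < e / 2"
    proof
      fix x assume "x \<in> X"
      then have "f x a \<in> cball 0 C" using bdd that by auto
      then have "f x a \<in> (\<Union>c\<in>N. ball c (e / 2))" using N(2) by (rule rev_subsetD)
      then show "\<exists>c. c \<in> N \<and> dist c (f x a) < e / 2" by (simp only: UN_iff mem_ball Bex_def)
    qed
    then show ?thesis by metis
  qed
  then obtain k where k: "\<And>a x. a \<in> Y \<Longrightarrow> x \<in> X \<Longrightarrow> k a x \<in> N \<and> dist (k a x) (f x a) < e / 2"
    by metis
  \<comment> \<open>\<open>restrict\<close> makes the codes extensional, so that they lie in a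
    finite \<open>PiE\<close>.\<close>
  define c where "c a = restrict (k a) X" for a
  have "c ` Y \<subseteq> PiE X (\<lambda>_. N)" using k by (auto simp: c_def)
  then have "finite (c ` Y)"
    using finite_PiE[OF \<open>finite X\<close>, of "\<lambda>_. N"] N(1) finite_subset by blast
  then obtain Z where Z: "Z \<subseteq> Y" "finite Z" "c ` Y = c ` Z"
    by (meson finite_subset_image subset_refl)
  have "\<exists>z\<in>Z. \<forall>x\<in>X. cmod (f x a - f x z) < e" if a: "a \<in> Y" for a
  proof -
    obtain z where z: "z \<in> Z" "c a = c z" using Z a by blast
    have "cmod (f x a - f x z) < e" if x: "x \<in> X" for x
    proof -
      have "k a x = k z x" using z(2) x by (metis c_def restrict_apply')
      moreover have "dist (k a x) (f x a) < e / 2" "dist (k z x) (f x z) < e / 2"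
        using k a x z Z by auto
      ultimately show ?thesis by (metis dist_norm dist_triangle_half_r)
    qed
    then show ?thesis using z by blast
  qed
  then show ?thesis using Z by blast
qed

text \<open>Schauder's theorem for bilinear forms: the values of the left slices at the finitely many
  points of a net for the right slices lie in a bounded subset of a finite-dimensional space.\<close>

lemma compact_op_transpose:
  fixes V W :: "'a::real_normed_vector \<Rightarrow>\<^sub>L 'a \<Rightarrow>\<^sub>L complex"
  assumes "compact_op (blinfun_apply V)"
    and VW: "\<And>a b. V a b = W b a"
  shows "compact_op (blinfun_apply W)"
proof (rule compact_opI)
  fix e :: real assume e: "0 < e"
  obtain X where X: "finite X" "\<And>x. x \<in> X \<Longrightarrow> norm x \<le> 1"
    "\<And>a. norm a \<le> 1 \<Longrightarrow> \<exists>x\<in>X. dist (V a) (V x) < e / 6"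
    using compact_opD[OF assms(1), of "e / 6"] e by auto
  have "cmod (V x b) \<le> norm V" if "x \<in> X" "b \<in> cball 0 1" for x b
    using norm_bilinear[of V x b] X(2)[OF that(1)] that(2) 
    by (metis dual_order.trans mem_cball_0 norm_le_unit_ball_apply)
  then obtain Z where Z: "finite Z" "Z \<subseteq> cball 0 1"
    "\<And>b. b \<in> cball 0 1 \<Longrightarrow> \<exists>z\<in>Z. \<forall>x\<in>X. cmod (V x b - V x z) < e / 6"
    using finite_net_bounded_functions[of X "cball 0 1" "\<lambda>x b. V x b" "norm V" "e / 6"] X(1) e
    by (auto simp: Ball_def)
  have "\<exists>z\<in>Z. dist (W b) (W z) < e" if b: "norm b \<le> 1" for b
  proof -
    obtain z where z: "z \<in> Z" "\<And>x. x \<in> X \<Longrightarrow> cmod (V x b - V x z) < e / 6"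
      using Z b by (meson mem_cball_0)
    \<comment> \<open>Three errors of \<open>e / 6\<close> follow. The supremum over
      \<open>a\<close> yields only a weak inequality, so the target is \<open>e / 2\<close>.\<close>
    have nz: "norm z \<le> 1" using z Z by auto
    have "norm (W b - W z) \<le> e / 2"
    proof (rule norm_le_unit_ball)
      fix a :: 'a assume a: "norm a \<le> 1"
      obtain x where x: "x \<in> X" "dist (V a) (V x) < e / 6" using X a by blast
      have *: "cmod (V a y - V x y) \<le> e / 6" if "norm y \<le> 1" for y
        using norm_le_unit_ball_apply[OF that, of "V a - V x"] x
        by (simp add: dist_norm blinfun.diff_left)
      have "dist (V a b) (V x b) \<le> e / 6" "dist (V a z) (V x z) \<le> e / 6"
        "dist (V x b) (V x z) < e / 6"
        using *[OF b] *[OF nz] z(2)[OF x(1)] by (auto simp: dist_norm)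
      then have "dist (V a b) (V a z) \<le> e / 2" by metric
      then show "norm ((W b - W z) a) \<le> e / 2"
        by (simp add: VW blinfun.diff_left dist_norm)
    qed (use e in auto)
    then show ?thesis using z e by (auto simp: dist_norm intro!: bexI[of _ z])
  qed
  then show "\<exists>X. finite X \<and> (\<forall>x\<in>X. norm x \<le> 1) \<and>
      (\<forall>a. norm a \<le> 1 \<longrightarrow> (\<exists>x\<in>X. dist (W a) (W x) < e))"
    using Z by (intro exI[of _ Z]) (auto simp: subset_iff)
qed

lemma bounded_linear_slice_left: "bounded_linear (slice_left W)"
  for W :: "'a::complex_banach \<Rightarrow>\<^sub>L 'a \<Rightarrow>\<^sub>L complex"
proof (rule bounded_linear_intro)
  show "norm (slice_left W b) \<le> norm b * norm W" for b
    using norm_slice_left_le[of W b] by (simp add: mult.commute)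
qed (auto intro!: blinfun_eqI simp: blinfun.add_left blinfun.add_right blinfun.scaleR_left blinfun.scaleR_right)

text \<open>Schauder's theorem in both directions; it makes the left and the right form of almost
  periodicity interchangeable.\<close>

lemma compact_op_slice_left_iff: "compact_op (slice_left W) \<longleftrightarrow> compact_op (blinfun_apply W)"
  for W :: "'a::complex_banach \<Rightarrow>\<^sub>L 'a \<Rightarrow>\<^sub>L complex"
proof -
  define V where "V = Blinfun (slice_left W)"
  have V: "slice_left W = blinfun_apply V"
    unfolding V_def by (simp add: bounded_linear_Blinfun_apply bounded_linear_slice_left)
  have "V a b = W b a" for a b
    by (metis V slice_left_apply)
  then show ?thesis
    unfolding V using compact_op_transpose[of V W] compact_op_transpose[of W V] by metis
qed

lemma tensor_apply_eq: "tensor F G a = F a *\<^sub>C G"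
  by (rule blinfun_eqI) simp

lemma blinfun_apply_sum: "blinfun_apply (\<Sum>i\<in>I. f i) x = (\<Sum>i\<in>I. blinfun_apply (f i) x)"
  by (induction I rule: infinite_finite_induct) (auto simp: blinfun.add_left)

lemma compact_op_tensor: "compact_op (blinfun_apply (tensor F G))"
proof (rule compact_op_subset_compact)
  show "compact ((\<lambda>c. c *\<^sub>C G) ` cball 0 (norm F))"
    by (intro compact_continuous_image linear_continuous_on bounded_linear_scaleC_left) simp
  fix a :: 'a assume "norm a \<le> 1"
  then have "F a \<in> cball 0 (norm F)" by (simp add: norm_le_unit_ball_apply)
  then show "tensor F G a \<in> (\<lambda>c. c *\<^sub>C G) ` cball 0 (norm F)"
    by (simp add: tensor_apply_eq)
qed

section \<open>Finite sums of elementary tensors and their closure\<close>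

definition tensor_sums ::
  "('a::complex_banach \<Rightarrow>\<^sub>L complex) set \<Rightarrow> ('a \<Rightarrow>\<^sub>L complex) set \<Rightarrow> ('a \<Rightarrow>\<^sub>L 'a \<Rightarrow>\<^sub>L complex) set" where
  "tensor_sums A B = {(\<Sum>i<n. tensor (F i) (G i)) | (n::nat) F G. (\<forall>i<n. F i \<in> A \<and> G i \<in> B)}"

lemma inj_tensor_eq_closure: "inj_tensor A B = closure (tensor_sums A B)"
  by (simp add: inj_tensor_def tensor_sums_def)

lemma tensor_sums_induct [consumes 1, case_names zero add]:
  assumes "W \<in> tensor_sums A B"
    and "P 0" and "\<And>V F G. V \<in> tensor_sums A B \<Longrightarrow> P V \<Longrightarrow> F \<in> A \<Longrightarrow> G \<in> B \<Longrightarrow> P (V + tensor F G)"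
  shows "P W"
proof -
  obtain n :: nat and F G where W: "W = (\<Sum>i<n. tensor (F i) (G i))" "\<forall>i<n. F i \<in> A \<and> G i \<in> B"
    using assms(1) by (auto simp: tensor_sums_def)
  have "m \<le> n \<Longrightarrow> P (\<Sum>i<m. tensor (F i) (G i))" for m
  proof (induction m)
    case (Suc m)
    have "(\<Sum>i<m. tensor (F i) (G i)) \<in> tensor_sums A B"
      unfolding tensor_sums_def mem_Collect_eq
      by (rule exI[of _ m], rule exI[of _ F], rule exI[of _ G]) (use W Suc.prems in auto)
    then show ?case using assms(3) Suc W(2) by simp
  qed (simp add: assms(2))
  then show ?thesis using W(1) by blast
qed

lemma tensor_sums_0: "0 \<in> tensor_sums A B"
  unfolding tensor_sums_def mem_Collect_eq by (rule exI[of _ 0]) simp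

lemma tensor_sums_add_tensor:
  assumes "W \<in> tensor_sums A B" "F \<in> A" "G \<in> B"
  shows "W + tensor F G \<in> tensor_sums A B"
proof -
  obtain n :: nat and F' G' where W: "W = (\<Sum>i<n. tensor (F' i) (G' i))" "\<forall>i<n. F' i \<in> A \<and> G' i \<in> B"
    using assms(1) by (auto simp: tensor_sums_def)
  have "W + tensor F G = (\<Sum>i<Suc n. tensor ((F'(n := F)) i) ((G'(n := G)) i))"
    by (simp add: W(1))
  moreover have "\<forall>i<Suc n. (F'(n := F)) i \<in> A \<and> (G'(n := G)) i \<in> B"
    using W(2) assms by (auto simp: less_Suc_eq)
  ultimately show ?thesis unfolding tensor_sums_def by blast
qed

lemma tensor_in_tensor_sums: "F \<in> A \<Longrightarrow> G \<in> B \<Longrightarrow> tensor F G \<in> tensor_sums A B"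
  using tensor_sums_add_tensor[OF tensor_sums_0, of F A G B] by simp

lemma tensor_sums_add:
  assumes V: "V \<in> tensor_sums A B" and W: "W \<in> tensor_sums A B"
  shows "V + W \<in> tensor_sums A B"
  using W
  by (induction rule: tensor_sums_induct)
     (auto simp: V tensor_sums_add_tensor simp flip: add.assoc)

lemma tensor_sums_sum:
  "(\<And>i. i \<in> I \<Longrightarrow> V i \<in> tensor_sums A B) \<Longrightarrow> (\<Sum>i\<in>I. V i) \<in> tensor_sums A B"
  by (induction I rule: infinite_finite_induct) (auto simp: tensor_sums_0 tensor_sums_add)

lemma tensor_scale_left: "tensor (c *\<^sub>C F) G = c *\<^sub>C tensor F G"
  by (intro blinfun_eqI) simp

lemma tensor_sums_scale:
  assumes "\<And>c F. F \<in> A \<Longrightarrow> c *\<^sub>C F \<in> A" and "W \<in> tensor_sums A B"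
  shows "c *\<^sub>C W \<in> tensor_sums A B"
  using assms(2)
  by (induction rule: tensor_sums_induct)
     (auto simp: tensor_sums_0 scaleC_add_right tensor_sums_add_tensor assms(1) simp flip: tensor_scale_left)

lemma tensor_sums_mono: "A \<subseteq> A' \<Longrightarrow> B \<subseteq> B' \<Longrightarrow> tensor_sums A B \<subseteq> tensor_sums A' B'"
  unfolding tensor_sums_def by blast

lemma inj_tensor_mono: "A \<subseteq> A' \<Longrightarrow> B \<subseteq> B' \<Longrightarrow> inj_tensor A B \<subseteq> inj_tensor A' B'"
  unfolding inj_tensor_eq_closure by (intro closure_mono tensor_sums_mono)

lemma tensor_sums_subset_cbil:
  assumes "A \<subseteq> cdual" "B \<subseteq> cdual" shows "tensor_sums A B \<subseteq> cbil"
proof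
  fix W assume "W \<in> tensor_sums A B"
  then show "W \<in> cbil"
    by (induction rule: tensor_sums_induct) (use assms in \<open>auto intro!: cbil_0 cbil_add tensor_in_cbil\<close>)
qed

lemma inj_tensor_subset_cbil: "A \<subseteq> cdual \<Longrightarrow> B \<subseteq> cdual \<Longrightarrow> inj_tensor A B \<subseteq> cbil"
  unfolding inj_tensor_eq_closure by (intro closure_minimal tensor_sums_subset_cbil closed_cbil)

lemma inj_tensor_approx:
  assumes "W \<in> inj_tensor A B" "0 < e"
  obtains V where "V \<in> tensor_sums A B" "norm (W - V) < e"
  using assms(1)[unfolded inj_tensor_eq_closure closure_approachable, THEN spec, THEN mp, OF assms(2)]
    that by (auto simp: dist_norm norm_minus_commute)

lemma tensor_sums_inj_tensor: "W \<in> tensor_sums A B \<Longrightarrow> W \<in> inj_tensor A B"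
  unfolding inj_tensor_eq_closure using closure_subset by blast

lemma inj_tensor_sequence:
  assumes "W \<in> inj_tensor A B"
  obtains V where "\<And>n. V n \<in> tensor_sums A B" "V \<longlonglongrightarrow> W"
  using assms[unfolded inj_tensor_eq_closure closure_sequential] by (elim exE conjE) (rule that; blast)

lemma inj_tensor_add:
  assumes "V \<in> inj_tensor A B" "W \<in> inj_tensor A B"
  shows "V + W \<in> inj_tensor A B"
  unfolding inj_tensor_eq_closure closure_approachable
proof (intro allI impI)
  fix e :: real assume e: "0 < e"
  obtain V' W' where *: "V' \<in> tensor_sums A B" "norm (V - V') < e / 2"
     "W' \<in> tensor_sums A B" "norm (W - W') < e / 2"
    using inj_tensor_approx assms e by (metis half_gt_zero)
  then have "dist (V' + W') (V + W) < e"
    using norm_triangle_ineq[of "V - V'" "W - W'"] 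
    by (simp add: dist_norm norm_minus_commute[of "V' + W'"] algebra_simps)
  then show "\<exists>y\<in>tensor_sums A B. dist y (V + W) < e" using * tensor_sums_add by blast
qed

lemma inj_tensor_scale:
  assumes A: "\<And>c F. F \<in> A \<Longrightarrow> c *\<^sub>C F \<in> A" and W: "W \<in> inj_tensor A B"
  shows "c *\<^sub>C W \<in> inj_tensor A B"
proof (cases "c = 0")
  case True
  then show ?thesis
    using tensor_sums_0 closure_subset unfolding inj_tensor_eq_closure by fastforce
next
  case False
  show ?thesis
    unfolding inj_tensor_eq_closure closure_approachable
  proof (intro allI impI)
    fix e :: real assume e: "0 < e"
    obtain V where V: "V \<in> tensor_sums A B" "norm (W - V) < e / cmod c"
      using inj_tensor_approx[OF W, of "e / cmod c"] e False by auto
    have "norm (c *\<^sub>C (V - W)) < e"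
      using V(2) False by (simp add: norm_scaleC norm_minus_commute field_simps)
    moreover have "c *\<^sub>C (V - W) = c *\<^sub>C V - c *\<^sub>C W"
      by (simp add: scaleC_diff_right)
    ultimately show "\<exists>y\<in>tensor_sums A B. dist y (c *\<^sub>C W) < e"
      using tensor_sums_scale[OF A V(1)] by (auto simp: dist_norm)
  qed
qed

text \<open>Elementary tensors have rank at most one, and compactness passes to sums and uniform
  limits. This turns membership in the tensor product back into almost periodicity.\<close>

lemma compact_op_inj_tensor:
  assumes "W \<in> inj_tensor A B"
  shows "compact_op (blinfun_apply W)"
proof (rule compact_op_uniform_limit)
  fix e :: real assume "0 < e"
  then obtain V where V: "V \<in> tensor_sums A B" "norm (W - V) < e"
    using inj_tensor_approx assms by blast
  have "compact_op (blinfun_apply V)"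
    using V(1)
  proof (induction rule: tensor_sums_induct)
    case zero
    show ?case by (rule compact_op_subset_compact[of "{0}"]) auto
  next
    case (add V F G)
    then show ?case
      using compact_op_add[OF add.IH compact_op_tensor] by (simp add: blinfun.add_left[abs_def])
  qed
  moreover have "dist (W a) (V a) < e" if "norm a \<le> 1" for a
    using norm_le_unit_ball_apply[OF that, of "W - V"] V(2) by (simp add: dist_norm blinfun.diff_left)
  ultimately show "\<exists>g. compact_op g \<and> (\<forall>a. norm a \<le> 1 \<longrightarrow> dist (W a) (g a) < e)" by blast
qed

section \<open>Almost periodic functionals: linear structure, closedness, stability under
  slicing\<close>

context comm_hopf_von_neumann
begin

text \<open>The action on \<open>F\<close> is \<open>slice_left (\<Delta> F)\<close>, and Schauder's
  theorem exchanges it for the operator \<open>\<Delta> F\<close> itself.\<close>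

lemma AP_iff: "F \<in> AP \<Delta> \<longleftrightarrow> F \<in> cdual \<and> compact_op (blinfun_apply (\<Delta> F))"
proof (cases "F \<in> cdual")
  case True
  then have "F \<in> AP \<Delta> \<longleftrightarrow> compact (closure (slice_left (\<Delta> F) ` cball 0 1))"
    by (simp add: AP_def act_eq)
  then show ?thesis
    using True by (simp flip: compact_op_iff_compact_closure add: compact_op_slice_left_iff)
qed (simp add: AP_def)

lemma AP_subset: "AP \<Delta> \<subseteq> cdual"
  by (auto simp: AP_def)

lemma AP_add: "F \<in> AP \<Delta> \<Longrightarrow> G \<in> AP \<Delta> \<Longrightarrow> F + G \<in> AP \<Delta>"
  using compact_op_add[of "blinfun_apply (\<Delta> F)" "blinfun_apply (\<Delta> G)"]
  by (auto simp: AP_iff Delta_add cdual_add blinfun.add_left[abs_def])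

lemma AP_scale: "F \<in> AP \<Delta> \<Longrightarrow> c *\<^sub>C F \<in> AP \<Delta>"
  unfolding AP_iff
proof (elim conjE, intro conjI cdual_scale)
  assume F: "F \<in> cdual" "compact_op (blinfun_apply (\<Delta> F))"
  show "compact_op (blinfun_apply (\<Delta> (c *\<^sub>C F)))"
  proof (rule compact_op_lipschitz[OF F(2)])
    fix a b
    have "c *\<^sub>C \<Delta> F a - c *\<^sub>C \<Delta> F b = c *\<^sub>C (\<Delta> F a - \<Delta> F b)"
      by (simp add: scaleC_diff_right)
    then show "dist (\<Delta> (c *\<^sub>C F) a) (\<Delta> (c *\<^sub>C F) b) \<le> cmod c * dist (\<Delta> F a) (\<Delta> F b)"
      using F by (simp add: Delta_scale dist_norm norm_scaleC)
  qed
qed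

lemma AP_one: "one \<in> AP \<Delta>"
  unfolding AP_iff Delta_one using compact_op_tensor[of one one] tensor_one L.one_closed by simp

text \<open>Since \<open>\<Delta>\<close> is bounded, \<open>\<Delta> G\<close> is close to
  \<open>\<Delta> F\<close> as an operator when \<open>G\<close> is close to \<open>F\<close>, and
  uniform limits of compact maps are compact.\<close>

lemma closed_AP: "closed (AP \<Delta>)"
proof -
  obtain C where C: "C > 0" "\<And>F. F \<in> cdual \<Longrightarrow> norm (\<Delta> F) \<le> C * norm F"
    using Delta_bounded by blast
  have "F \<in> AP \<Delta>" if F: "F \<in> closure (AP \<Delta>)" for F
  proof -
    have "closure (AP \<Delta>) \<subseteq> cdual"
      by (intro closure_minimal AP_subset L.closed_carrier)
    then have Fc: "F \<in> cdual" using F by blast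
    have "compact_op (blinfun_apply (\<Delta> F))"
    proof (rule compact_op_uniform_limit)
      fix e :: real assume e: "0 < e"
      then obtain G where G: "G \<in> AP \<Delta>" "dist G F < e / C"
        using F C(1) unfolding closure_approachable by (metis divide_pos_pos)
      then have Gc: "G \<in> cdual" using AP_subset by blast
      have "norm (\<Delta> F - \<Delta> G) \<le> C * norm (F - G)"
        using C(2)[OF cdual_diff[OF Fc Gc]] by (simp add: Delta_diff Fc Gc)
      also have "\<dots> < e"
        using G(2) C(1) by (simp add: dist_norm norm_minus_commute field_simps)
      finally have n: "norm (\<Delta> F - \<Delta> G) < e" .
      have "dist (\<Delta> F a) (\<Delta> G a) < e" if "norm a \<le> 1" for a
        using norm_le_unit_ball_apply[OF that, of "\<Delta> F - \<Delta> G"] n by (simp add: dist_norm blinfun.diff_left)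
      then show "\<exists>g. compact_op g \<and> (\<forall>a. norm a \<le> 1 \<longrightarrow> dist (\<Delta> F a) (g a) < e)"
        using G(1) AP_iff by blast
    qed
    then show ?thesis using Fc by (simp add: AP_iff)
  qed
  then show ?thesis using closure_subset_eq by blast
qed

text \<open>Both sides are the value of \<open>F\<close> at the product of \<open>a\<close>,
  \<open>b\<close> and \<open>c\<close>, bracketed in the two possible ways.\<close>

lemma coassoc_apply: "F \<in> cdual \<Longrightarrow> \<Delta> (\<Delta> F a) b c = \<Delta> (slice_left (\<Delta> F) c) a b"
  using fun_cong[OF fun_cong[OF fun_cong[OF coassoc[of F], of a], of b], of c]
  by (simp add: id_tensor_def tensor_id_def)

lemma norm_Delta_apply_le:
  assumes "\<And>F. F \<in> cdual \<Longrightarrow> norm (\<Delta> F) \<le> C * norm F" "F \<in> cdual" "G \<in> cdual"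
  shows "dist (\<Delta> F a) (\<Delta> G a) \<le> C * norm a * dist F G"
proof -
  have "dist (\<Delta> F a) (\<Delta> G a) \<le> norm (\<Delta> (F - G)) * norm a"
    using norm_blinfun[of "\<Delta> (F - G)" a] by (simp add: Delta_diff assms dist_norm blinfun.diff_left)
  also have "\<dots> \<le> C * norm (F - G) * norm a"
    using assms by (intro mult_right_mono) (auto simp: cdual_diff)
  finally show ?thesis by (simp add: dist_norm mult_ac)
qed

text \<open>By coassociativity the left slices of \<open>\<Delta> (\<Delta> F a)\<close> are the
  images of those of \<open>\<Delta> F\<close> under the bounded map
  \<open>G \<mapsto> \<Delta> G a\<close>.\<close>

lemma Delta_apply_AP:
  assumes F: "F \<in> AP \<Delta>"
  shows "\<Delta> F a \<in> AP \<Delta>"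
proof -
  obtain C where C: "C > 0" "\<And>F. F \<in> cdual \<Longrightarrow> norm (\<Delta> F) \<le> C * norm F"
    using Delta_bounded by blast
  have Fc: "F \<in> cdual" and F': "compact_op (slice_left (\<Delta> F))"
    using F by (auto simp: AP_iff compact_op_slice_left_iff)
  note W = Delta_closed[OF Fc]
  have "slice_left (\<Delta> (\<Delta> F a)) c = \<Delta> (slice_left (\<Delta> F) c) a" for c
    by (rule blinfun_eqI) (simp add: coassoc_apply Fc)
  then have "compact_op (slice_left (\<Delta> (\<Delta> F a)))"
    using norm_Delta_apply_le[OF C(2) cbil_slice_left[OF W] cbil_slice_left[OF W]]
    by (intro compact_op_lipschitz[OF F', of _ "C * norm a"]) auto
  then show ?thesis using W by (simp add: AP_iff compact_op_slice_left_iff cbil_right)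
qed

text \<open>The mirror image: here the compact map is \<open>\<Delta> F\<close> and the bounded map
  after it is \<open>G \<mapsto> slice_left (\<Delta> G) c\<close>.\<close>

lemma slice_left_Delta_AP:
  assumes F: "F \<in> AP \<Delta>"
  shows "slice_left (\<Delta> F) c \<in> AP \<Delta>"
proof -
  obtain C where C: "C > 0" "\<And>F. F \<in> cdual \<Longrightarrow> norm (\<Delta> F) \<le> C * norm F"
    using Delta_bounded by blast
  have Fc: "F \<in> cdual" and F': "compact_op (blinfun_apply (\<Delta> F))"
    using F by (auto simp: AP_iff)
  note W = Delta_closed[OF Fc]
  have eq: "\<Delta> (slice_left (\<Delta> F) c) a = slice_left (\<Delta> (\<Delta> F a)) c" for a
    by (rule blinfun_eqI) (simp add: coassoc_apply Fc)
  have "compact_op (blinfun_apply (\<Delta> (slice_left (\<Delta> F) c)))"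
  proof (rule compact_op_lipschitz[OF F'])
    fix a b
    have "slice_left (\<Delta> (\<Delta> F a)) c - slice_left (\<Delta> (\<Delta> F b)) c = slice_left (\<Delta> (\<Delta> F a - \<Delta> F b)) c"
      using Delta_diff[OF cbil_right[OF W] cbil_right[OF W]]
      by (intro blinfun_eqI) (simp add: blinfun.diff_left)
    then have "dist (slice_left (\<Delta> (\<Delta> F a)) c) (slice_left (\<Delta> (\<Delta> F b)) c)
        \<le> norm (\<Delta> (\<Delta> F a - \<Delta> F b)) * norm c"
      by (simp add: dist_norm norm_slice_left_le)
    also have "\<dots> \<le> C * norm (\<Delta> F a - \<Delta> F b) * norm c"
      using C(2) W by (intro mult_right_mono) (auto intro: cdual_diff cbil_right)
    finally show "dist (\<Delta> (slice_left (\<Delta> F) c) a) (\<Delta> (slice_left (\<Delta> F) c) b)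
        \<le> C * norm c * dist (\<Delta> F a) (\<Delta> F b)"
      by (simp add: eq dist_norm mult_ac)
  qed
  then show ?thesis using W by (simp add: AP_iff cbil_slice_left)
qed

section \<open>Multiplication and involution on injective tensor products\<close>

lemma star2_norm: "W \<in> cbil \<Longrightarrow> norm (star2 W) = norm W"
proof -
  have le: "norm W \<le> norm (star2 W)" if W: "W \<in> cbil" for W
  proof (cases "W = 0")
    case False
    have "norm W * norm W \<le> norm (star2 W) * norm W"
      using LL.cstar_identity[OF W] LL.norm_mult_le[OF LL.star_closed[OF W] W]
      by (simp add: power2_eq_square)
    then show ?thesis using False by simp
  qed simp
  assume W: "W \<in> cbil"
  show ?thesis
    using le[OF W] le[OF LL.star_closed[OF W]] by (simp add: LL.star_star[OF W])
qed

lemma mul2_add_left: "U \<in> cbil \<Longrightarrow> V \<in> cbil \<Longrightarrow> W \<in> cbil \<Longrightarrow> mul2 (U + V) W = mul2 U W + mul2 V W"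
  using LL.mult_add[of W U V] by (simp add: LL.mult_comm[of _ W] cbil_add)

lemma mul2_diff_left: "U \<in> cbil \<Longrightarrow> V \<in> cbil \<Longrightarrow> W \<in> cbil \<Longrightarrow> mul2 (U - V) W = mul2 U W - mul2 V W"
  using mul2_add_left[of "U - V" V W] by (simp add: cbil_diff)

lemma mul2_diff_right: "U \<in> cbil \<Longrightarrow> V \<in> cbil \<Longrightarrow> W \<in> cbil \<Longrightarrow> mul2 U (V - W) = mul2 U V - mul2 U W"
  using LL.mult_add[of U "V - W" W] by (simp add: cbil_diff)

lemma mul2_0: "W \<in> cbil \<Longrightarrow> mul2 0 W = 0" "W \<in> cbil \<Longrightarrow> mul2 W 0 = 0"
  using mul2_diff_left[of 0 0 W] mul2_diff_right[of W 0 0] by (auto simp: cbil_0)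

lemma star2_0: "star2 0 = 0"
  using star2_norm[OF cbil_0] by simp

lemma star2_diff: "U \<in> cbil \<Longrightarrow> V \<in> cbil \<Longrightarrow> star2 (U - V) = star2 U - star2 V"
  using LL.star_add[of "U - V" V] by (simp add: cbil_diff)

lemma norm_mul2_diff_le:
  assumes "V \<in> cbil" "W \<in> cbil" "V' \<in> cbil" "W' \<in> cbil"
  shows "norm (mul2 V W - mul2 V' W') \<le> norm (V - V') * norm W + norm V' * norm (W - W')"
proof -
  have "mul2 V W - mul2 V' W' = mul2 (V - V') W + mul2 V' (W - W')"
    using assms by (simp add: mul2_diff_left mul2_diff_right)
  also have "norm \<dots> \<le> norm (mul2 (V - V') W) + norm (mul2 V' (W - W'))"
    by (rule norm_triangle_ineq)
  also have "\<dots> \<le> norm (V - V') * norm W + norm V' * norm (W - W')"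
    using assms by (intro add_mono LL.norm_mult_le) (auto intro: cbil_diff)
  finally show ?thesis .
qed

lemma mul2_tendsto:
  assumes "\<And>n. V n \<in> cbil" "\<And>n. W n \<in> cbil" "v \<in> cbil" "w \<in> cbil" "V \<longlonglongrightarrow> v" "W \<longlonglongrightarrow> w"
  shows "(\<lambda>n. mul2 (V n) (W n)) \<longlonglongrightarrow> mul2 v w"
proof -
  have "(\<lambda>n. norm (V n - v) * norm (W n) + norm v * norm (W n - w)) \<longlonglongrightarrow> norm (v - v) * norm w + norm v * norm (w - w)"
    by (intro tendsto_intros assms)
  then have "(\<lambda>n. norm (V n - v) * norm (W n) + norm v * norm (W n - w)) \<longlonglongrightarrow> 0" by simp
  then have "(\<lambda>n. mul2 (V n) (W n) - mul2 v w) \<longlonglongrightarrow> 0"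
    by (rule Lim_null_comparison[rotated]) (use norm_mul2_diff_le assms in \<open>auto intro!: always_eventually\<close>)
  then show ?thesis by (simp add: LIM_zero_iff)
qed

lemma star2_tendsto:
  assumes "\<And>n. V n \<in> cbil" "v \<in> cbil" "V \<longlonglongrightarrow> v"
  shows "(\<lambda>n. star2 (V n)) \<longlonglongrightarrow> star2 v"
proof -
  have "norm (star2 (V n) - star2 v) = norm (V n - v)" for n
    using star2_norm[of "V n - v"] assms by (simp add: star2_diff cbil_diff)
  then show ?thesis
    using assms(3) by (simp add: tendsto_iff dist_norm)
qed

lemma mul2_tensor_sums:
  assumes A: "A \<subseteq> cdual" and mul: "\<And>F G. F \<in> A \<Longrightarrow> G \<in> A \<Longrightarrow> mul F G \<in> A"
    and V: "V \<in> tensor_sums A A" and W: "W \<in> tensor_sums A A"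
  shows "mul2 V W \<in> tensor_sums A A"
proof -
  have sub: "tensor_sums A A \<subseteq> cbil" using A by (intro tensor_sums_subset_cbil)
  have *: "mul2 V (tensor F G) \<in> tensor_sums A A" if FG: "F \<in> A" "G \<in> A" for F G
    using V
  proof (induction rule: tensor_sums_induct)
    case zero
    have "tensor F G \<in> cbil" using FG A by (auto intro: tensor_in_cbil)
    then show ?case by (simp add: mul2_0 tensor_sums_0)
  next
    case (add V F' G')
    moreover have "V \<in> cbil" using add sub by blast
    ultimately show ?case
      using FG A mul
      by (auto simp: mul2_add_left tensor_in_cbil tensor_mult subset_iff intro!: tensor_sums_add_tensor)
  qed
  show ?thesis
    using W
  proof (induction rule: tensor_sums_induct)
    case zero
    have "V \<in> cbil" using V sub by blast
    then show ?case by (simp add: mul2_0 tensor_sums_0)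
  next
    case (add W F G)
    moreover have "V \<in> cbil" "W \<in> cbil" "tensor F G \<in> cbil" using V add sub A by (auto intro: tensor_in_cbil)
    ultimately show ?case using * by (auto simp: LL.mult_add intro: tensor_sums_add)
  qed
qed

lemma star2_tensor_sums:
  assumes A: "A \<subseteq> cdual" and star: "\<And>F. F \<in> A \<Longrightarrow> star F \<in> A"
    and W: "W \<in> tensor_sums A A"
  shows "star2 W \<in> tensor_sums A A"
  using W
proof (induction rule: tensor_sums_induct)
  case (add V F G)
  moreover have "V \<in> cbil" using add A tensor_sums_subset_cbil by blast
  ultimately show ?case
    using A star by (auto simp: LL.star_add tensor_in_cbil tensor_star subset_iff intro!: tensor_sums_add_tensor)
qed (simp add: star2_0 tensor_sums_0)

text \<open>Kept general in \<open>A\<close> for two uses: with \<open>A = cdual\<close> it shows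
  that \<open>AP \<Delta>\<close> is closed under products, after which
  \<open>A = AP \<Delta>\<close> is admissible too.\<close>

lemma mul2_inj_tensor:
  assumes A: "A \<subseteq> cdual" and mul: "\<And>F G. F \<in> A \<Longrightarrow> G \<in> A \<Longrightarrow> mul F G \<in> A"
    and V: "V \<in> inj_tensor A A" and W: "W \<in> inj_tensor A A"
  shows "mul2 V W \<in> inj_tensor A A"
proof -
  note sub = tensor_sums_subset_cbil[OF A A] and sub' = inj_tensor_subset_cbil[OF A A]
  obtain Vn Wn where *: "\<And>n. Vn n \<in> tensor_sums A A" "Vn \<longlonglongrightarrow> V" "\<And>n. Wn n \<in> tensor_sums A A" "Wn \<longlonglongrightarrow> W"
    using V[unfolded inj_tensor_eq_closure closure_sequential]
      W[unfolded inj_tensor_eq_closure closure_sequential] by (elim exE conjE) (rule that; blast)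
  have "(\<lambda>n. mul2 (Vn n) (Wn n)) \<longlonglongrightarrow> mul2 V W"
    using * sub sub' V W by (intro mul2_tendsto) auto
  moreover have "\<forall>n. mul2 (Vn n) (Wn n) \<in> tensor_sums A A"
    using * by (intro allI mul2_tensor_sums[OF A mul])
  ultimately show ?thesis
    unfolding inj_tensor_eq_closure closure_sequential by (intro exI conjI)
qed

lemma star2_inj_tensor:
  assumes A: "A \<subseteq> cdual" and star: "\<And>F. F \<in> A \<Longrightarrow> star F \<in> A"
    and W: "W \<in> inj_tensor A A"
  shows "star2 W \<in> inj_tensor A A"
proof -
  note sub = tensor_sums_subset_cbil[OF A A] and sub' = inj_tensor_subset_cbil[OF A A]
  obtain Wn where *: "\<And>n. Wn n \<in> tensor_sums A A" "Wn \<longlonglongrightarrow> W"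
    using W[unfolded inj_tensor_eq_closure closure_sequential] by (elim exE conjE) (rule that; blast)
  have "(\<lambda>n. star2 (Wn n)) \<longlonglongrightarrow> star2 W"
    using * sub sub' W by (intro star2_tendsto) auto
  moreover have "\<forall>n. star2 (Wn n) \<in> tensor_sums A A"
    using * by (intro allI star2_tensor_sums[OF A star])
  ultimately show ?thesis
    unfolding inj_tensor_eq_closure closure_sequential by (intro exI conjI)
qed

end

section \<open>The injective tensor square of a space isometric to \<open>C(K)\<close>\<close>

lemma cmod_le_sup_norm:
  assumes "compact_space K" "continuous_map K euclidean f" "s \<in> topspace K"
  shows "cmod (f s) \<le> sup_norm K f"
proof -
  have "compact (f ` topspace K)"
    using image_compactin[OF _ assms(2)] assms(1) by (simp add: compact_space_def)
  then obtain B where "\<And>s. s \<in> topspace K \<Longrightarrow> cmod (f s) \<le> B"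
    using compact_imp_bounded bounded_iff by (metis imageI)
  then have "bdd_above (insert 0 ((\<lambda>s. cmod (f s)) ` topspace K))"
    by (intro bdd_aboveI[of _ "max 0 B"]) (auto simp: le_max_iff_disj)
  then show ?thesis
    unfolding sup_norm_def by (rule cSup_upper[rotated]) (use assms(3) in auto)
qed

lemma sup_norm_le:
  assumes "\<And>s. s \<in> topspace K \<Longrightarrow> cmod (f s) \<le> c" "0 \<le> c"
  shows "sup_norm K f \<le> c"
  unfolding sup_norm_def using assms by (intro cSup_least) auto

lemma continuous_map_mult_algebra:
  fixes f g :: "'k \<Rightarrow> 'b::real_normed_algebra"
  shows "continuous_map X euclidean f \<Longrightarrow> continuous_map X euclidean g \<Longrightarrow> continuous_map X euclidean (\<lambda>x. f x * g x)"
  by (simp add: continuous_map_atin tendsto_mult)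

lemma continuous_map_complex_of_real:
  "continuous_map X euclideanreal f \<Longrightarrow> continuous_map X euclidean (\<lambda>x. complex_of_real (f x))"
  by (simp add: continuous_map_atin tendsto_of_real)

lemma compact_space_finite_subcover:
  assumes "compact_space K" "\<And>p. p \<in> topspace K \<Longrightarrow> openin K (U p) \<and> p \<in> U p"
  obtains P where "finite P" "P \<subseteq> topspace K" "topspace K \<subseteq> (\<Union>p\<in>P. U p)"
proof -
  have "\<exists>\<F>. finite \<F> \<and> \<F> \<subseteq> U ` topspace K \<and> topspace K \<subseteq> \<Union>\<F>"
    by (rule assms(1)[unfolded compact_space_alt, THEN spec, THEN mp]) (use assms(2) in auto)
  then obtain \<F> where \<F>: "finite \<F>" "\<F> \<subseteq> U ` topspace K" "topspace K \<subseteq> \<Union>\<F>"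
    by (elim exE conjE)
  obtain P where "P \<subseteq> topspace K" "finite P" "\<F> = U ` P"
    using finite_subset_image[OF \<F>(1,2)] by (elim exE conjE)
  then show ?thesis using that[of P] \<F>(3) by simp
qed

text \<open>The bumps are made from the family itself: \<open>\<rho> p s\<close> is positive exactly
  when the total deviation of the family from its values at \<open>p\<close> is below
  \<open>e\<close>. Compactness leaves finitely many of them, and dividing by their sum
  normalises.\<close>

lemma partition_of_unity_oscillation:
  fixes \<F> :: "('k \<Rightarrow> complex) set"
  assumes K: "compact_space K" and fin: "finite \<F>"
    and cont: "\<And>f. f \<in> \<F> \<Longrightarrow> continuous_map K euclidean f" and e: "0 < e"
  obtains P \<phi> where "finite P" "P \<subseteq> topspace K"
    "\<And>p. p \<in> P \<Longrightarrow> continuous_map K euclideanreal (\<phi> p)"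
    "\<And>p s. p \<in> P \<Longrightarrow> s \<in> topspace K \<Longrightarrow> 0 \<le> \<phi> p s"
    "\<And>s. s \<in> topspace K \<Longrightarrow> (\<Sum>p\<in>P. \<phi> p s) = 1"
    "\<And>p s f. p \<in> P \<Longrightarrow> s \<in> topspace K \<Longrightarrow> \<phi> p s \<noteq> 0 \<Longrightarrow> f \<in> \<F> \<Longrightarrow> cmod (f s - f p) < e"
proof -
  define \<rho> where "\<rho> p s = max 0 (e - (\<Sum>f\<in>\<F>. cmod (f s - f p)))" for p s
  have cont\<rho>: "continuous_map K euclideanreal (\<rho> p)" for p
    unfolding \<rho>_def using cont fin by (intro continuous_intros) auto
  have "openin K {s \<in> topspace K. \<rho> p s \<in> {0<..}}" for p
    by (rule openin_continuous_map_preimage[OF cont\<rho>]) simp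
  then have "openin K {s \<in> topspace K. 0 < \<rho> p s}" for p by simp
  moreover have "0 < \<rho> p p" for p using e by (simp add: \<rho>_def)
  ultimately obtain P where P: "finite P" "P \<subseteq> topspace K"
    "topspace K \<subseteq> (\<Union>p\<in>P. {s \<in> topspace K. 0 < \<rho> p s})"
    using compact_space_finite_subcover[OF K, of "\<lambda>p. {s \<in> topspace K. 0 < \<rho> p s}"] by auto
  define \<sigma> where "\<sigma> s = (\<Sum>p\<in>P. \<rho> p s)" for s
  have nonneg: "0 \<le> \<rho> p s" for p s by (simp add: \<rho>_def)
  have pos: "0 < \<sigma> s" if s: "s \<in> topspace K" for s
  proof -
    obtain p where "p \<in> P" "0 < \<rho> p s" using P(3) s by blast
    then show ?thesis unfolding \<sigma>_def using P(1) nonneg by (intro sum_pos2) auto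
  qed
  show ?thesis
  proof (rule that[of P "\<lambda>p s. \<rho> p s / \<sigma> s"])
    show "continuous_map K euclideanreal (\<lambda>s. \<rho> p s / \<sigma> s)" if "p \<in> P" for p
      unfolding \<sigma>_def using P(1) pos
      by (intro continuous_map_real_divide continuous_map_sum cont\<rho>) (auto simp: \<sigma>_def order_less_le)
    show "0 \<le> \<rho> p s / \<sigma> s" if "p \<in> P" "s \<in> topspace K" for p s
      using nonneg[of p s] pos[OF that(2)] by simp
    show "(\<Sum>p\<in>P. \<rho> p s / \<sigma> s) = 1" if "s \<in> topspace K" for s
      using pos[OF that] by (simp add: \<sigma>_def flip: sum_divide_distrib)
    show "cmod (f s - f p) < e" if "p \<in> P" "s \<in> topspace K" "\<rho> p s / \<sigma> s \<noteq> 0" "f \<in> \<F>" for p s f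
    proof -
      have "(\<Sum>f\<in>\<F>. cmod (f s - f p)) < e"
        using that(3) by (auto simp: \<rho>_def max_def split: if_splits)
      moreover have "cmod (f s - f p) \<le> (\<Sum>f\<in>\<F>. cmod (f s - f p))"
        using that(4) fin by (intro member_le_sum) auto
      ultimately show ?thesis by simp
    qed
  qed (use P in auto)
qed

text \<open>The error is a weighted average of the errors \<open>z - c p\<close>. Terms of weight
  zero are exempt, so for a partition of unity only the points \<open>p\<close> whose support
  contains the argument matter.\<close>

lemma cmod_convex_sum_le:
  assumes "finite P" "\<And>p. p \<in> P \<Longrightarrow> 0 \<le> \<phi> p" "(\<Sum>p\<in>P. \<phi> p) = 1"
    "\<And>p. p \<in> P \<Longrightarrow> \<phi> p \<noteq> 0 \<Longrightarrow> cmod (z - c p) \<le> d"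
  shows "cmod (z - (\<Sum>p\<in>P. c p * complex_of_real (\<phi> p))) \<le> d"
proof -
  have "z = (\<Sum>p\<in>P. z * complex_of_real (\<phi> p))"
    using assms(3) by (simp flip: sum_distrib_left of_real_sum)
  then have "z - (\<Sum>p\<in>P. c p * complex_of_real (\<phi> p)) = (\<Sum>p\<in>P. (z - c p) * complex_of_real (\<phi> p))"
    by (metis (mono_tags, lifting) left_diff_distrib sum.cong sum_subtractf)
  also have "cmod \<dots> \<le> (\<Sum>p\<in>P. cmod (z - c p) * \<phi> p)"
    using norm_sum by (rule order_trans) (use assms(2) in \<open>simp add: norm_mult\<close>)
  also have "\<dots> \<le> (\<Sum>p\<in>P. d * \<phi> p)"
  proof (rule sum_mono)
    fix p assume p: "p \<in> P"
    show "cmod (z - c p) * \<phi> p \<le> d * \<phi> p"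
      using assms(2)[OF p] assms(4)[OF p] by (cases "\<phi> p = 0") (auto intro: mult_right_mono)
  qed
  also have "\<dots> = d" using assms(3) by (simp flip: sum_distrib_left)
  finally show ?thesis .
qed

text \<open>Only the Banach space structure of \<open>E\<close> enters here. This matters: that \<open>AP\<close> is closed under
  multiplication is derived below from the tensor product approximation established in this locale.\<close>

locale isometric_function_space =
  fixes E :: "('a::complex_banach \<Rightarrow>\<^sub>L complex) set" and K :: "'k topology"
    and \<Phi> :: "('a \<Rightarrow>\<^sub>L complex) \<Rightarrow> 'k \<Rightarrow> complex"
  assumes E_cdual: "E \<subseteq> cdual" and closed_E: "closed E"
    and E_add: "\<And>F G. F \<in> E \<Longrightarrow> G \<in> E \<Longrightarrow> F + G \<in> E"
    and E_scale: "\<And>c F. F \<in> E \<Longrightarrow> c *\<^sub>C F \<in> E"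
    and compact_K: "compact_space K"
    and Phi_add: "\<And>F G s. F \<in> E \<Longrightarrow> G \<in> E \<Longrightarrow> s \<in> topspace K \<Longrightarrow> \<Phi> (F + G) s = \<Phi> F s + \<Phi> G s"
    and Phi_scale: "\<And>c F s. F \<in> E \<Longrightarrow> s \<in> topspace K \<Longrightarrow> \<Phi> (c *\<^sub>C F) s = c * \<Phi> F s"
    and Phi_bij: "bij_betw \<Phi> E (C_space K)"
    and Phi_norm: "\<And>F. F \<in> E \<Longrightarrow> sup_norm K (\<Phi> F) = norm F"
begin

lemma Phi_continuous: "F \<in> E \<Longrightarrow> continuous_map K euclidean (\<Phi> F)"
  using bij_betwE[OF Phi_bij] by (auto simp: C_space_def)

lemma Phi_onto:
  assumes "continuous_map K euclidean f"
  obtains F where "F \<in> E" "\<And>s. s \<in> topspace K \<Longrightarrow> \<Phi> F s = f s"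
proof -
  have "restrict f (topspace K) \<in> C_space K"
    unfolding C_space_def using continuous_map_eq[OF assms, of "restrict f (topspace K)"] by simp
  then obtain F where "F \<in> E" "\<Phi> F = restrict f (topspace K)"
    using bij_betw_imp_surj_on[OF Phi_bij] by (metis imageE)
  then show ?thesis using that by simp
qed

lemma Phi_onto_ex:
  assumes "continuous_map K euclidean f"
  shows "\<exists>F\<in>E. \<forall>s\<in>topspace K. \<Phi> F s = f s"
  by (rule Phi_onto[OF assms]) (rule bexI, simp_all)

lemma Phi_le: "F \<in> E \<Longrightarrow> s \<in> topspace K \<Longrightarrow> cmod (\<Phi> F s) \<le> norm F"
  using cmod_le_sup_norm[OF compact_K Phi_continuous] Phi_norm by simp

lemma norm_le_Phi: "F \<in> E \<Longrightarrow> (\<And>s. s \<in> topspace K \<Longrightarrow> cmod (\<Phi> F s) \<le> c) \<Longrightarrow> 0 \<le> c \<Longrightarrow> norm F \<le> c"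
  using sup_norm_le[of K "\<Phi> F" c] Phi_norm by simp

lemma E_0: "0 \<in> E"
proof -
  obtain F where "F \<in> E" using Phi_onto[of "\<lambda>_. 0"] by auto
  then show ?thesis using E_scale[of F 0] by simp
qed

lemma E_diff: "F \<in> E \<Longrightarrow> G \<in> E \<Longrightarrow> F - G \<in> E"
  using E_add[of F "(-1) *\<^sub>C G"] E_scale[of G "-1"] by (simp add: scaleC_minus_one)

lemma Phi_0: "s \<in> topspace K \<Longrightarrow> \<Phi> 0 s = 0"
  using Phi_scale[OF E_0, of s 0] by simp

lemma Phi_diff: "F \<in> E \<Longrightarrow> G \<in> E \<Longrightarrow> s \<in> topspace K \<Longrightarrow> \<Phi> (F - G) s = \<Phi> F s - \<Phi> G s"
  using Phi_add[of "F - G" G s] by (simp add: E_diff)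

lemma Phi_inject:
  assumes "F \<in> E" "G \<in> E" "\<And>s. s \<in> topspace K \<Longrightarrow> \<Phi> F s = \<Phi> G s"
  shows "F = G"
  using norm_le_Phi[of "F - G" 0] assms by (simp add: E_diff Phi_diff)

lemma E_sum: "(\<And>i. i \<in> I \<Longrightarrow> F i \<in> E) \<Longrightarrow> (\<Sum>i\<in>I. F i) \<in> E"
  by (induction I rule: infinite_finite_induct) (auto simp: E_0 E_add)

lemma Phi_sum:
  "(\<And>i. i \<in> I \<Longrightarrow> F i \<in> E) \<Longrightarrow> s \<in> topspace K \<Longrightarrow> \<Phi> (\<Sum>i\<in>I. F i) s = (\<Sum>i\<in>I. \<Phi> (F i) s)"
  by (induction I rule: infinite_finite_induct) (auto simp: Phi_0 E_sum Phi_add)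

text \<open>A special case of Goldstine's theorem. If \<open>B\<close> corresponds to a bump function \<open>\<beta>\<close> with
  \<open>0 \<le> \<beta> \<le> 1 = \<beta> s\<close> and \<open>B a\<close> is nearly \<open>1 = \<parallel>B\<parallel>\<close>, then \<open>a\<close> is concentrated near \<open>s\<close>:
  since \<open>\<beta> + \<theta> (1 - \<beta>)\<close> is bounded by \<open>1\<close> whenever \<open>\<bar>\<theta>\<bar> \<le> 1\<close>, functions of the form
  \<open>f (1 - \<beta>)\<close> are nearly annihilated by \<open>a\<close>.\<close>

lemma approximate_evaluation:
  assumes fin: "finite \<F>" and sub: "\<F> \<subseteq> E" and s: "s \<in> topspace K" and e: "0 < e"
  obtains a where "norm a \<le> 1" "\<And>F. F \<in> \<F> \<Longrightarrow> cmod (F a - \<Phi> F s) < e"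
proof -
  \<comment> \<open>The summand 1 keeps \<open>M\<close> positive, also for an empty family.\<close>
  define M where "M = 1 + (\<Sum>F\<in>\<F>. norm F)"
  have M: "1 \<le> M" by (simp add: M_def sum_nonneg)
  have leM: "cmod (\<Phi> F p) \<le> M" if "F \<in> \<F>" "p \<in> topspace K" for F p
  proof -
    have "cmod (\<Phi> F p) \<le> norm F" using Phi_le that sub by blast
    also have "\<dots> \<le> (\<Sum>F\<in>\<F>. norm F)" using that fin by (intro member_le_sum) auto
    finally show ?thesis by (simp add: M_def)
  qed
  \<comment> \<open>The final error is \<open>M * \<eta> + \<delta> + M * \<eta>\<close>, three
    quarters of \<open>e\<close>.\<close>
  define \<delta> \<eta> where "\<delta> = e / 4" and "\<eta> = e / (4 * M)"
  have \<delta>: "0 < \<delta>" and \<eta>: "0 < \<eta>" using e M by (auto simp: \<delta>_def \<eta>_def)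
  define \<beta> where "\<beta> p = max 0 (1 - (\<Sum>F\<in>\<F>. cmod (\<Phi> F p - \<Phi> F s)) / \<delta>)" for p
  have \<beta>01: "0 \<le> \<beta> p" "\<beta> p \<le> 1" for p using \<delta> by (auto simp: \<beta>_def sum_nonneg)
  have \<beta>s: "\<beta> s = 1" by (simp add: \<beta>_def)
  have \<beta>_small: "cmod (\<Phi> F p - \<Phi> F s) * \<beta> p \<le> \<delta>" if F: "F \<in> \<F>" for F p
  proof (cases "\<beta> p = 0")
    case False
    then have "(\<Sum>F\<in>\<F>. cmod (\<Phi> F p - \<Phi> F s)) < \<delta>"
      using \<delta> by (auto simp: \<beta>_def max_def field_simps split: if_splits)
    moreover have "cmod (\<Phi> F p - \<Phi> F s) \<le> (\<Sum>F\<in>\<F>. cmod (\<Phi> F p - \<Phi> F s))"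
      using F fin by (intro member_le_sum) auto
    ultimately have "cmod (\<Phi> F p - \<Phi> F s) \<le> \<delta>" by simp
    then have "cmod (\<Phi> F p - \<Phi> F s) * \<beta> p \<le> \<delta> * 1"
      using \<beta>01 \<delta> by (intro mult_mono) auto
    then show ?thesis by simp
  qed (use \<delta> in auto)
  have "continuous_map K euclideanreal \<beta>"
    unfolding \<beta>_def using fin \<delta> sub Phi_continuous by (intro continuous_intros) auto
  then have cont\<beta>: "continuous_map K euclidean (\<lambda>p. complex_of_real (\<beta> p))"
    by (rule continuous_map_complex_of_real)
  then obtain B where B: "B \<in> E" "\<And>p. p \<in> topspace K \<Longrightarrow> \<Phi> B p = complex_of_real (\<beta> p)"
    using Phi_onto by blast
  have Bc: "B \<in> cdual" using B E_cdual by blast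
  have "1 \<le> norm B" using Phi_le[OF B(1) s] B(2)[OF s] \<beta>s by simp
  have "\<exists>a0. norm a0 \<le> 1 \<and> 1 - \<eta> < cmod (B a0)"
  proof (rule ccontr)
    assume "\<not> ?thesis"
    \<comment> \<open>\<open>1 - \<eta>\<close> may be negative, whereas a norm bound has to be
      nonnegative.\<close>
    then have "norm B \<le> max 0 (1 - \<eta>)"
      by (intro norm_le_unit_ball) (auto simp: not_less le_max_iff_disj)
    then show False using \<open>1 \<le> norm B\<close> \<eta> by simp
  qed
  then obtain a0 where a0: "norm a0 \<le> 1" "1 - \<eta> < cmod (B a0)" by blast
  \<comment> \<open>Correcting the phase makes \<open>B a\<close> real and nonnegative, so that a
    modulus close to 1 becomes a value close to 1.\<close>
  define a where "a = cnj (sgn (B a0)) *\<^sub>C a0"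
  have phase: "cnj (sgn z) * z = complex_of_real (cmod z)" for z
  proof (cases "z = 0")
    case False
    have "cnj (sgn z) * z = (z * cnj z) / complex_of_real (cmod z)" by (simp add: sgn_eq)
    also have "\<dots> = complex_of_real (cmod z)"
      using False by (simp add: power2_eq_square flip: complex_norm_square)
    finally show ?thesis .
  qed simp
  have phase_le: "cmod (cnj (sgn z)) \<le> 1" for z :: complex by (simp add: norm_sgn)
  have a: "norm a \<le> 1"
    using mult_mono[OF phase_le[of "B a0"] a0(1)] by (simp add: a_def norm_scaleC)
  have Ba: "B a = complex_of_real (cmod (B a0))"
    using phase by (simp add: a_def cdual_scaleC[OF Bc])
  have "cmod (B a0) \<le> norm B" by (rule norm_le_unit_ball_apply[OF a0(1)])
  also have "\<dots> \<le> 1" using B \<beta>01 by (intro norm_le_Phi) auto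
  finally have "cmod (B a0) \<le> 1" .
  moreover have "B a - 1 = complex_of_real (cmod (B a0) - 1)" by (simp add: Ba)
  ultimately have Ba1: "cmod (B a - 1) \<le> \<eta>"
    using a0(2) by (simp only: norm_of_real)
  show ?thesis
  proof (rule that[OF a])
    fix F assume F: "F \<in> \<F>"
    then have FE: "F \<in> E" using sub by blast
    have cont: "continuous_map K euclidean (\<lambda>p. \<Phi> F p * (1 - complex_of_real (\<beta> p)))"
       "continuous_map K euclidean (\<lambda>p. (\<Phi> F p - \<Phi> F s) * complex_of_real (\<beta> p))"
      using Phi_continuous[OF FE] cont\<beta>
      by (intro continuous_map_mult_algebra continuous_map_diff; simp)+
    obtain H where H: "H \<in> E" "\<And>p. p \<in> topspace K \<Longrightarrow> \<Phi> H p = \<Phi> F p * (1 - complex_of_real (\<beta> p))"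
      using Phi_onto[OF cont(1)] by blast
    obtain G where G: "G \<in> E" "\<And>p. p \<in> topspace K \<Longrightarrow> \<Phi> G p = (\<Phi> F p - \<Phi> F s) * complex_of_real (\<beta> p)"
      using Phi_onto[OF cont(2)] by blast
    \<comment> \<open>\<open>F\<close> splits into its part away from \<open>s\<close>, its
      oscillation near \<open>s\<close>, and the constant \<open>\<Phi> F s\<close> times the bump.
      The first two are nearly annihilated by \<open>a\<close>.\<close>
    have "F = H + G + \<Phi> F s *\<^sub>C B"
    proof (rule Phi_inject)
      fix p assume p: "p \<in> topspace K"
      have "\<Phi> (H + G + \<Phi> F s *\<^sub>C B) p = \<Phi> H p + \<Phi> G p + \<Phi> F s * \<Phi> B p"
        using H(1) G(1) B(1) p by (simp add: E_add E_scale Phi_add Phi_scale)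
      also have "\<dots> = \<Phi> F p"
        unfolding H(2)[OF p] G(2)[OF p] B(2)[OF p] by (simp add: algebra_simps)
      finally show "\<Phi> F p = \<Phi> (H + G + \<Phi> F s *\<^sub>C B) p" by (rule sym)
    qed (use FE H(1) G(1) B(1) in \<open>auto intro: E_add E_scale\<close>)
    then have "F a = H a + G a + \<Phi> F s * B a"
      by (metis blinfun.add_left blinfun_apply_scaleC scaleC_complex)
    then have eq: "F a - \<Phi> F s = H a + G a + \<Phi> F s * (B a - 1)" by (simp add: algebra_simps)
    have "norm G \<le> \<delta>"
      using G \<beta>_small[OF F] \<beta>01 \<delta> by (intro norm_le_Phi) (auto simp: norm_mult)
    then have Ga: "cmod (G a) \<le> \<delta>" using norm_le_unit_ball_apply[OF a, of G] by simp
    have Ha: "cmod (H a) \<le> M * \<eta>"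
    proof -
      \<comment> \<open>\<open>\<Phi> H\<close> is at most \<open>M * (1 - \<beta> p)\<close> in
        modulus, so adding it with any phase to \<open>M\<close> times the bump keeps the norm at
        most \<open>M\<close>. At \<open>a\<close> the bump alone already uses all but
        \<open>M * \<eta>\<close> of this bound, and what remains bounds \<open>H a\<close>.\<close>
      define Q where "Q = complex_of_real M *\<^sub>C B + cnj (sgn (H a)) *\<^sub>C H"
      have QE: "Q \<in> E" using B H by (auto simp: Q_def E_add E_scale)
      have "norm Q \<le> M"
      proof (rule norm_le_Phi[OF QE])
        fix p assume p: "p \<in> topspace K"
        have h: "cmod (\<Phi> H p) \<le> M * (1 - \<beta> p)"
        proof -
          have "\<Phi> H p = \<Phi> F p * complex_of_real (1 - \<beta> p)"
            using H(2)[OF p] by simp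
          then have "cmod (\<Phi> H p) = cmod (\<Phi> F p) * \<bar>1 - \<beta> p\<bar>"
            by (simp only: norm_mult norm_of_real)
          also have "\<dots> \<le> M * (1 - \<beta> p)"
            using leM[OF F p] M \<beta>01[of p] by (intro mult_mono) auto
          finally show ?thesis .
        qed
        have "\<Phi> Q p = complex_of_real M * \<Phi> B p + cnj (sgn (H a)) * \<Phi> H p"
          using B(1) H(1) p by (simp add: Q_def Phi_add Phi_scale E_scale)
        then have "cmod (\<Phi> Q p) \<le> M * \<beta> p + cmod (cnj (sgn (H a))) * cmod (\<Phi> H p)"
          using norm_triangle_ineq[of "complex_of_real M * \<Phi> B p" "cnj (sgn (H a)) * \<Phi> H p"] M \<beta>01[of p] B(2)[OF p]
          by (simp add: norm_mult del: complex_mod_cnj)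
        also have "\<dots> \<le> M * \<beta> p + 1 * (M * (1 - \<beta> p))"
          using phase_le h by (intro add_left_mono mult_mono) auto
        finally show "cmod (\<Phi> Q p) \<le> M" by (simp add: algebra_simps)
      qed (use M in auto)
      then have "cmod (Q a) \<le> M" using norm_le_unit_ball_apply[OF a, of Q] by simp
      moreover have "Q a = complex_of_real (M * cmod (B a0) + cmod (H a))"
        using phase[of "H a"] by (simp add: Q_def blinfun.add_left Ba)
      ultimately have "M * cmod (B a0) + cmod (H a) \<le> M"
        using M by (simp only: norm_of_real)
      moreover have "M * (1 - \<eta>) \<le> M * cmod (B a0)"
        using a0(2) M by (intro mult_left_mono) auto
      ultimately show ?thesis by (simp add: algebra_simps)
    qed
    have "cmod (\<Phi> F s * (B a - 1)) \<le> M * \<eta>"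
      using leM[OF F s] Ba1 M by (simp add: norm_mult mult_mono)
    then have "cmod (F a - \<Phi> F s) \<le> M * \<eta> + \<delta> + M * \<eta>"
      unfolding eq using Ha Ga by (intro norm_triangle_le add_mono) auto
    also have "\<dots> < e" using M e by (simp add: \<eta>_def \<delta>_def field_simps)
    finally show "cmod (F a - \<Phi> F s) < e" .
  qed
qed

text \<open>A quantitative approximation property of C(K): \<open>S\<close> is \<open>W\<close>
  followed by the finite-rank map that sends \<open>G\<close> to the sum of the
  \<open>G (b p) *\<^sub>C \<Psi> p\<close>. Right slices in \<open>E\<close> give sense to
  \<open>\<Phi> (W a)\<close>; left slices in \<open>E\<close> put \<open>S\<close> among the tensor
  sums.\<close>

lemma inj_tensorI:
  assumes W: "W \<in> cbil" and right: "\<And>a. W a \<in> E" and left: "\<And>b. slice_left W b \<in> E"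
    and comp: "compact_op (blinfun_apply W)"
  shows "W \<in> inj_tensor E E"
  unfolding inj_tensor_eq_closure closure_approachable
proof (intro allI impI)
  fix e :: real assume e: "0 < e"
  \<comment> \<open>Four errors of size \<open>d\<close> will add up; the fifth part leaves room for
    strictness.\<close>
  define d where "d = e / 5"
  have d: "0 < d" using e by (simp add: d_def)
  obtain X where X: "finite X" "\<And>x. x \<in> X \<Longrightarrow> norm x \<le> 1"
    "\<And>a. norm a \<le> 1 \<Longrightarrow> \<exists>x\<in>X. dist (W a) (W x) < d"
    using compact_opD[OF comp d] by blast
  obtain P \<phi> where P: "finite P" "P \<subseteq> topspace K"
    "\<And>p. p \<in> P \<Longrightarrow> continuous_map K euclideanreal (\<phi> p)"
    "\<And>p s. p \<in> P \<Longrightarrow> s \<in> topspace K \<Longrightarrow> 0 \<le> \<phi> p s"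
    "\<And>s. s \<in> topspace K \<Longrightarrow> (\<Sum>p\<in>P. \<phi> p s) = 1"
    "\<And>p s f. p \<in> P \<Longrightarrow> s \<in> topspace K \<Longrightarrow> \<phi> p s \<noteq> 0 \<Longrightarrow> f \<in> (\<lambda>x. \<Phi> (W x)) ` X \<Longrightarrow> cmod (f s - f p) < d"
    by (rule partition_of_unity_oscillation[OF compact_K, of "(\<lambda>x. \<Phi> (W x)) ` X" d])
       (use X(1) d right Phi_continuous in auto)
  \<comment> \<open>Only the finitely many functionals \<open>W x\<close> of the net have to be
    evaluated almost correctly; every other \<open>W a\<close> is within \<open>d\<close> of one of
    them.\<close>
  have "\<exists>b. norm b \<le> 1 \<and> (\<forall>x\<in>X. cmod (W x b - \<Phi> (W x) p) < d)" if "p \<in> P" for p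
    by (rule approximate_evaluation[of "blinfun_apply W ` X" p d])
       (use that P(2) X(1) d right in auto)
  then obtain b where b: "\<And>p. p \<in> P \<Longrightarrow> norm (b p) \<le> 1"
    "\<And>p x. p \<in> P \<Longrightarrow> x \<in> X \<Longrightarrow> cmod (W x (b p) - \<Phi> (W x) p) < d"
    by metis
  have "\<exists>F\<in>E. \<forall>s\<in>topspace K. \<Phi> F s = complex_of_real (\<phi> p s)" if "p \<in> P" for p
    by (rule Phi_onto_ex[OF continuous_map_complex_of_real[OF P(3)[OF that]]])
  then obtain \<Psi> where \<Psi>: "\<And>p. p \<in> P \<Longrightarrow> \<Psi> p \<in> E"
    "\<And>p s. p \<in> P \<Longrightarrow> s \<in> topspace K \<Longrightarrow> \<Phi> (\<Psi> p) s = complex_of_real (\<phi> p s)"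
    by metis
  define S where "S = (\<Sum>p\<in>P. tensor (slice_left W (b p)) (\<Psi> p))"
  have S: "S \<in> tensor_sums E E"
    unfolding S_def using \<Psi> left by (intro tensor_sums_sum tensor_in_tensor_sums) auto
  have "norm (W - S) \<le> 4 * d"
  proof (rule norm_le_unit_ball)
    fix a :: 'a assume a: "norm a \<le> 1"
    have Sa: "S a = (\<Sum>p\<in>P. W a (b p) *\<^sub>C \<Psi> p)"
      by (simp add: S_def blinfun_apply_sum tensor_apply_eq)
    have SaE: "S a \<in> E" unfolding Sa using \<Psi> by (intro E_sum E_scale) auto
    have "norm (W a - S a) \<le> 4 * d"
    proof (rule norm_le_Phi)
      fix s assume s: "s \<in> topspace K"
      have "\<Phi> (W a - S a) s = \<Phi> (W a) s - (\<Sum>p\<in>P. W a (b p) * complex_of_real (\<phi> p s))"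
        using s \<Psi> SaE right by (simp add: Phi_diff) (simp add: Sa Phi_sum E_scale Phi_scale)
      also have "cmod \<dots> \<le> 4 * d"
      proof (rule cmod_convex_sum_le)
        fix p assume p: "p \<in> P" "\<phi> p s \<noteq> 0"
        obtain x where x: "x \<in> X" "dist (W a) (W x) < d" using X(3) a by blast
        \<comment> \<open>The path from \<open>\<Phi> (W a) s\<close> to \<open>W a (b p)\<close>:
          replace \<open>a\<close> by the net point \<open>x\<close>, move from \<open>s\<close> to
          \<open>p\<close>, replace the point \<open>p\<close> by \<open>b p\<close>, and return
          from \<open>x\<close> to \<open>a\<close>.\<close>
        have 1: "dist (\<Phi> (W a) s) (\<Phi> (W x) s) \<le> d"
          using Phi_le[OF E_diff[OF right right] s, of a x] x(2) right s by (simp add: Phi_diff dist_norm)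
        have 2: "dist (\<Phi> (W x) s) (\<Phi> (W x) p) \<le> d"
          using P(6)[OF p(1) s p(2) imageI[OF x(1)]] by (simp add: dist_norm)
        have 3: "dist (W x (b p)) (\<Phi> (W x) p) \<le> d" using b(2)[OF p(1) x(1)] by (simp add: dist_norm)
        have 4: "dist (W a (b p)) (W x (b p)) \<le> d"
          using norm_le_unit_ball_apply[OF b(1)[OF p(1)], of "W a - W x"] x(2)
          by (simp add: dist_norm blinfun.diff_left)
        have "dist (\<Phi> (W a) s) (W a (b p)) \<le> 4 * d" using 1 2 3 4 by metric
        then show "cmod (\<Phi> (W a) s - W a (b p)) \<le> 4 * d" by (simp add: dist_norm)
      qed (use P s in auto)
      finally show "cmod (\<Phi> (W a - S a) s) \<le> 4 * d" .
    qed (use d right SaE E_diff in auto)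
    then show "norm ((W - S) a) \<le> 4 * d" by (simp add: blinfun.diff_left)
  qed (use d in auto)
  also have "\<dots> < e" using e by (simp add: d_def)
  finally show "\<exists>V\<in>tensor_sums E E. dist V W < e"
    using S by (auto simp: dist_norm norm_minus_commute)
qed

lemma inj_tensor_cbil: "W \<in> inj_tensor E E \<Longrightarrow> W \<in> cbil"
  using inj_tensor_subset_cbil[OF E_cdual E_cdual] by blast

lemma inj_tensor_apply:
  assumes "W \<in> inj_tensor E E"
  shows "W a \<in> E"
proof -
  have sums: "V a \<in> E" if "V \<in> tensor_sums E E" for V
    using that by (induction rule: tensor_sums_induct) (auto simp: E_0 blinfun.add_left tensor_apply_eq E_add E_scale)
  obtain V where V: "\<And>n. V n \<in> tensor_sums E E" "V \<longlonglongrightarrow> W" using inj_tensor_sequence assms by blast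
  have "(\<lambda>n. V n a) \<longlonglongrightarrow> W a" by (intro tendsto_intros V(2))
  then show ?thesis using closed_sequentially[OF closed_E, of "\<lambda>n. V n a"] sums V(1) by blast
qed

section \<open>Evaluation at pairs of points and the identification with C(K x K)\<close>

text \<open>This is the identity tensored with evaluation at \<open>t\<close>. A bounded functional
  results as soon as \<open>W\<close> is in \<open>cbil\<close> with right slices in
  \<open>E\<close>; that it lies in \<open>E\<close> again is shown only on the injective tensor
  product.\<close>

definition slice_at :: "'k \<Rightarrow> ('a \<Rightarrow>\<^sub>L 'a \<Rightarrow>\<^sub>L complex) \<Rightarrow> ('a \<Rightarrow>\<^sub>L complex)" where
  "slice_at t W = Blinfun (\<lambda>a. \<Phi> (W a) t)"

lemma slice_at_apply:
  assumes W: "W \<in> cbil" "\<And>a. W a \<in> E" and t: "t \<in> topspace K"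
  shows "slice_at t W a = \<Phi> (W a) t"
proof -
  have "bounded_linear (\<lambda>a. \<Phi> (W a) t)"
  proof (rule bounded_linear_intro)
    show "\<Phi> (W (x + y)) t = \<Phi> (W x) t + \<Phi> (W y) t" for x y
      using W t by (simp add: blinfun.add_right Phi_add)
    show "\<Phi> (W (r *\<^sub>R x)) t = r *\<^sub>R \<Phi> (W x) t" for r x
      using W t Phi_scale[of "W x" t "complex_of_real r"]
      by (simp add: blinfun.scaleR_right scaleC_of_real scaleR_conv_of_real)
    show "norm (\<Phi> (W x) t) \<le> norm x * norm W" for x
      using Phi_le[OF W(2) t, of x] norm_blinfun[of W x] by (simp add: mult.commute)
  qed
  then show ?thesis unfolding slice_at_def by (simp add: bounded_linear_Blinfun_apply)
qed

lemma slice_at_inj_tensor_apply: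
  "W \<in> inj_tensor E E \<Longrightarrow> t \<in> topspace K \<Longrightarrow> slice_at t W a = \<Phi> (W a) t"
  by (simp add: slice_at_apply inj_tensor_cbil inj_tensor_apply)

lemma inj_tensor_E_scale: "W \<in> inj_tensor E E \<Longrightarrow> c *\<^sub>C W \<in> inj_tensor E E"
  by (rule inj_tensor_scale[OF E_scale])

lemma inj_tensor_E_diff: "V \<in> inj_tensor E E \<Longrightarrow> W \<in> inj_tensor E E \<Longrightarrow> V - W \<in> inj_tensor E E"
  using inj_tensor_add[of V E E "(-1) *\<^sub>C W"] inj_tensor_E_scale[of W "-1"] by (simp add: scaleC_minus_one)

lemma slice_at_add: "V \<in> inj_tensor E E \<Longrightarrow> W \<in> inj_tensor E E \<Longrightarrow> t \<in> topspace K \<Longrightarrow>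
    slice_at t (V + W) = slice_at t V + slice_at t W"
  by (rule blinfun_eqI)
     (simp add: slice_at_inj_tensor_apply inj_tensor_add blinfun.add_left inj_tensor_apply Phi_add)

lemma slice_at_scale: "W \<in> inj_tensor E E \<Longrightarrow> t \<in> topspace K \<Longrightarrow>
    slice_at t (c *\<^sub>C W) = c *\<^sub>C slice_at t W"
  by (rule blinfun_eqI)
     (simp add: slice_at_inj_tensor_apply inj_tensor_E_scale inj_tensor_apply Phi_scale)

lemma norm_slice_at_le: "W \<in> inj_tensor E E \<Longrightarrow> t \<in> topspace K \<Longrightarrow> norm (slice_at t W) \<le> norm W"
  by (rule norm_blinfun_bound)
     (auto simp: slice_at_inj_tensor_apply inj_tensor_apply intro: order_trans[OF Phi_le] norm_blinfun)

lemma tensor_inj_tensor: "F \<in> E \<Longrightarrow> G \<in> E \<Longrightarrow> tensor F G \<in> inj_tensor E E"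
  by (intro tensor_sums_inj_tensor tensor_in_tensor_sums)

lemma slice_at_tensor: "F \<in> E \<Longrightarrow> G \<in> E \<Longrightarrow> t \<in> topspace K \<Longrightarrow> slice_at t (tensor F G) = \<Phi> G t *\<^sub>C F"
  by (rule blinfun_eqI) (simp add: slice_at_inj_tensor_apply tensor_inj_tensor tensor_apply_eq Phi_scale)

lemma slice_at_diff: "V \<in> inj_tensor E E \<Longrightarrow> W \<in> inj_tensor E E \<Longrightarrow> t \<in> topspace K \<Longrightarrow>
    slice_at t (V - W) = slice_at t V - slice_at t W"
  using slice_at_add[of "V - W" W t] by (simp add: inj_tensor_E_diff)

text \<open>On an elementary tensor the slice is a multiple of the first factor; contractivity of
  slicing and closedness of \<open>E\<close> carry this to the closure. It is what permits applying
  \<open>\<Phi>\<close> a second time.\<close>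

lemma slice_at_E:
  assumes W: "W \<in> inj_tensor E E" and t: "t \<in> topspace K"
  shows "slice_at t W \<in> E"
proof -
  have sums: "slice_at t V \<in> E" if "V \<in> tensor_sums E E" for V
    using that
  proof (induction rule: tensor_sums_induct)
    case zero
    have "slice_at t 0 = 0"
      using slice_at_scale[OF tensor_sums_inj_tensor[OF tensor_sums_0] t, of 0] by simp
    then show ?case by (simp add: E_0)
  next
    case (add V F G)
    then show ?case using t
      by (simp add: slice_at_add tensor_sums_inj_tensor tensor_inj_tensor slice_at_tensor E_add E_scale)
  qed
  obtain V where V: "\<And>n. V n \<in> tensor_sums E E" "V \<longlonglongrightarrow> W" using inj_tensor_sequence W by blast
  have "(\<lambda>n. norm (V n - W)) \<longlonglongrightarrow> 0" using V(2) by (simp add: LIM_zero tendsto_norm_zero)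
  then have "(\<lambda>n. slice_at t (V n) - slice_at t W) \<longlonglongrightarrow> 0"
    by (rule Lim_null_comparison[rotated])
       (use norm_slice_at_le[OF inj_tensor_E_diff t] V(1) W t in
         \<open>auto intro!: always_eventually simp: tensor_sums_inj_tensor simp flip: slice_at_diff\<close>)
  then have "(\<lambda>n. slice_at t (V n)) \<longlonglongrightarrow> slice_at t W" by (simp add: LIM_zero_iff)
  then show ?thesis using closed_sequentially[OF closed_E, of "\<lambda>n. slice_at t (V n)"] sums V(1) by blast
qed

text \<open>The usual identification, as \<open>Theta_tensor\<close> shows: elementary tensors
  become product functions. \<open>restrict\<close> is there because members of
  \<open>C_space\<close> are extensional.\<close>

definition \<Theta> :: "('a \<Rightarrow>\<^sub>L 'a \<Rightarrow>\<^sub>L complex) \<Rightarrow> 'k \<times> 'k \<Rightarrow> complex" where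
  "\<Theta> W = restrict (\<lambda>(s, t). \<Phi> (slice_at t W) s) (topspace K \<times> topspace K)"

lemma Theta_apply: "s \<in> topspace K \<Longrightarrow> t \<in> topspace K \<Longrightarrow> \<Theta> W (s, t) = \<Phi> (slice_at t W) s"
  by (simp add: \<Theta>_def)

lemma Theta_add:
  "V \<in> inj_tensor E E \<Longrightarrow> W \<in> inj_tensor E E \<Longrightarrow> s \<in> topspace K \<Longrightarrow> t \<in> topspace K \<Longrightarrow>
    \<Theta> (V + W) (s, t) = \<Theta> V (s, t) + \<Theta> W (s, t)"
  by (simp add: Theta_apply slice_at_add slice_at_E Phi_add)

lemma Theta_diff:
  "V \<in> inj_tensor E E \<Longrightarrow> W \<in> inj_tensor E E \<Longrightarrow> s \<in> topspace K \<Longrightarrow> t \<in> topspace K \<Longrightarrow>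
    \<Theta> (V - W) (s, t) = \<Theta> V (s, t) - \<Theta> W (s, t)"
  by (simp add: Theta_apply slice_at_diff slice_at_E Phi_diff)

lemma Theta_scale:
  "W \<in> inj_tensor E E \<Longrightarrow> s \<in> topspace K \<Longrightarrow> t \<in> topspace K \<Longrightarrow> \<Theta> (c *\<^sub>C W) (s, t) = c * \<Theta> W (s, t)"
  by (simp add: Theta_apply slice_at_scale slice_at_E Phi_scale)

lemma Theta_tensor:
  "F \<in> E \<Longrightarrow> G \<in> E \<Longrightarrow> s \<in> topspace K \<Longrightarrow> t \<in> topspace K \<Longrightarrow> \<Theta> (tensor F G) (s, t) = \<Phi> F s * \<Phi> G t"
  by (simp add: Theta_apply slice_at_tensor Phi_scale)

lemma Theta_0: "s \<in> topspace K \<Longrightarrow> t \<in> topspace K \<Longrightarrow> \<Theta> 0 (s, t) = 0"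
  using Theta_scale[OF tensor_sums_inj_tensor[OF tensor_sums_0], of s t 0] by simp

lemma Theta_sum:
  "(\<And>i. i \<in> I \<Longrightarrow> W i \<in> inj_tensor E E) \<Longrightarrow> s \<in> topspace K \<Longrightarrow> t \<in> topspace K \<Longrightarrow>
    (\<Sum>i\<in>I. W i) \<in> inj_tensor E E \<and> \<Theta> (\<Sum>i\<in>I. W i) (s, t) = (\<Sum>i\<in>I. \<Theta> (W i) (s, t))"
  by (induction I rule: infinite_finite_induct)
     (auto simp: Theta_0 Theta_add inj_tensor_add tensor_sums_inj_tensor tensor_sums_0)

lemma Theta_le: "W \<in> inj_tensor E E \<Longrightarrow> s \<in> topspace K \<Longrightarrow> t \<in> topspace K \<Longrightarrow> cmod (\<Theta> W (s, t)) \<le> norm W"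
  by (metis Theta_apply Phi_le slice_at_E norm_slice_at_le order_trans)

text \<open>The norm of a bilinear form is an iterated supremum over unit balls. In each variable
  the ball may be exchanged for \<open>K\<close>: the second variable for fixed \<open>a\<close>,
  then the first for fixed \<open>t\<close>.\<close>

lemma norm_le_Theta:
  assumes W: "W \<in> inj_tensor E E" and "0 \<le> c"
    and le: "\<And>s t. s \<in> topspace K \<Longrightarrow> t \<in> topspace K \<Longrightarrow> cmod (\<Theta> W (s, t)) \<le> c"
  shows "norm W \<le> c"
proof (rule norm_le_unit_ball[OF _ \<open>0 \<le> c\<close>])
  fix a :: 'a assume a: "norm a \<le> 1"
  show "norm (W a) \<le> c"
  proof (rule norm_le_Phi[OF inj_tensor_apply[OF W] _ \<open>0 \<le> c\<close>])
    fix t assume t: "t \<in> topspace K"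
    have "norm (slice_at t W) \<le> c"
      using le t by (intro norm_le_Phi slice_at_E W \<open>0 \<le> c\<close>) (auto simp: Theta_apply)
    then have "cmod (slice_at t W a) \<le> c"
      using norm_le_unit_ball_apply[OF a, of "slice_at t W"] by simp
    then show "cmod (\<Phi> (W a) t) \<le> c" by (simp add: slice_at_inj_tensor_apply W t)
  qed
qed

lemma Theta_tendsto:
  assumes V: "\<And>n. V n \<in> inj_tensor E E" and W: "W \<in> inj_tensor E E" and lim: "V \<longlonglongrightarrow> W"
    and s: "s \<in> topspace K" and t: "t \<in> topspace K"
  shows "(\<lambda>n. \<Theta> (V n) (s, t)) \<longlonglongrightarrow> \<Theta> W (s, t)"
proof -
  have "(\<lambda>n. norm (V n - W)) \<longlonglongrightarrow> 0" using lim by (simp add: LIM_zero tendsto_norm_zero)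
  then have "(\<lambda>n. \<Theta> (V n) (s, t) - \<Theta> W (s, t)) \<longlonglongrightarrow> 0"
    by (rule Lim_null_comparison[rotated])
       (use Theta_le[OF inj_tensor_E_diff s t] V W s t in
         \<open>auto intro!: always_eventually simp flip: Theta_diff\<close>)
  then show ?thesis by (simp add: LIM_zero_iff)
qed

lemma Theta_continuous:
  assumes W: "W \<in> inj_tensor E E"
  shows "continuous_map (prod_topology K K) euclidean (\<Theta> W)"
proof -
  have sums: "continuous_map (prod_topology K K) euclidean (\<Theta> V)" if "V \<in> tensor_sums E E" for V
    using that
  proof (induction rule: tensor_sums_induct)
    case zero
    show ?case by (rule continuous_map_eq[of _ _ "\<lambda>_. 0"]) (auto simp: Theta_0)
  next
    case (add V F G)
    have "continuous_map (prod_topology K K) euclidean (\<lambda>p. \<Theta> V p + \<Phi> F (fst p) * \<Phi> G (snd p))"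
      using add Phi_continuous continuous_map_compose[OF continuous_map_fst[of K K] Phi_continuous[of F]]
        continuous_map_compose[OF continuous_map_snd[of K K] Phi_continuous[of G]]
      by (intro continuous_map_add continuous_map_mult_algebra) (auto simp: o_def)
    then show ?case
      by (rule continuous_map_eq)
         (use add in \<open>auto simp: Theta_add Theta_tensor tensor_sums_inj_tensor tensor_inj_tensor\<close>)
  qed
  obtain V where V: "\<And>n. V n \<in> tensor_sums E E" "V \<longlonglongrightarrow> W" using inj_tensor_sequence W by blast
  have "continuous_map (prod_topology K K) Met_TC.mtopology (\<Theta> W)"
  proof (rule Met_TC.continuous_map_uniform_limit[where f = "\<lambda>n. \<Theta> (V n)" and F = sequentially])
    show "\<forall>\<^sub>F n in sequentially. continuous_map (prod_topology K K) Met_TC.mtopology (\<Theta> (V n))"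
      using sums V by simp
    fix e :: real assume "0 < e"
    then have "\<forall>\<^sub>F n in sequentially. dist (V n) W < e" using V(2) by (simp add: tendsto_iff)
    then show "\<forall>\<^sub>F n in sequentially. \<forall>x\<in>topspace (prod_topology K K). \<Theta> W x \<in> UNIV \<and> dist (\<Theta> (V n) x) (\<Theta> W x) < e"
    proof eventually_elim
      case (elim n)
      have "dist (\<Theta> (V n) (s, t)) (\<Theta> W (s, t)) < e" if "s \<in> topspace K" "t \<in> topspace K" for s t
        using Theta_le[OF inj_tensor_E_diff[OF tensor_sums_inj_tensor[OF V(1)[of n]] W] that] elim that W V(1)
        by (simp add: Theta_diff tensor_sums_inj_tensor dist_norm)
      then show ?case by auto
    qed
  qed simp
  then show ?thesis by simp
qed

text \<open>By the tube lemma finitely many sections \<open>h (x, t)\<close> represent all sections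
  up to \<open>d\<close>, uniformly in \<open>t\<close>. A partition of unity adapted to these
  sections discretises the second variable, and the coefficients are the sections
  \<open>h (s, p)\<close>.\<close>

lemma Theta_dense:
  assumes h: "continuous_map (prod_topology K K) euclidean h" and e: "0 < e"
  shows "\<exists>V\<in>inj_tensor E E. \<forall>s\<in>topspace K. \<forall>t\<in>topspace K. cmod (h (s, t) - \<Theta> V (s, t)) \<le> e"
proof -
  define d where "d = e / 3"
  have d: "0 < d" using e by (simp add: d_def)
  have h1: "continuous_map K euclidean (\<lambda>s. h (s, p))" if "p \<in> topspace K" for p
    using continuous_map_compose[OF _ h, of K "\<lambda>s. (s, p)"] that by (simp add: o_def continuous_map_pairedI)
  have h2: "continuous_map K euclidean (\<lambda>t. h (x, t))" if "x \<in> topspace K" for x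
    using continuous_map_compose[OF _ h, of K "\<lambda>t. (x, t)"] that by (simp add: o_def continuous_map_pairedI)
  have "\<exists>U. openin K U \<and> x \<in> U \<and> (\<forall>s\<in>U. \<forall>t\<in>topspace K. cmod (h (s, t) - h (x, t)) < d)"
    if x: "x \<in> topspace K" for x
  proof -
    define W where "W = {z \<in> topspace (prod_topology K K). cmod (h z - h (x, snd z)) \<in> {..<d}}"
    have "continuous_map (prod_topology K K) euclideanreal (\<lambda>z. cmod (h z - h (x, snd z)))"
      using continuous_map_compose[OF continuous_map_snd h2[OF x], of K]
      by (intro continuous_map_norm continuous_map_diff h) (simp add: o_def)
    then have W: "openin (prod_topology K K) W"
      unfolding W_def by (rule openin_continuous_map_preimage) simp
    have "{x} \<times> topspace K \<subseteq> W" using x d by (auto simp: W_def)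
    then obtain U V where "openin K U" "x \<in> U" "topspace K \<subseteq> V" "U \<times> V \<subseteq> W"
      using tube_lemma_right[OF W _ x, of "topspace K"] compact_K by (auto simp: compact_space_def)
    then have "(s, t) \<in> W" if "s \<in> U" "t \<in> topspace K" for s t using that by blast
    then show ?thesis using \<open>openin K U\<close> \<open>x \<in> U\<close> by (intro exI[of _ U]) (auto simp: W_def)
  qed
  then obtain U where U: "\<And>x. x \<in> topspace K \<Longrightarrow> openin K (U x) \<and> x \<in> U x"
    "\<And>x s t. x \<in> topspace K \<Longrightarrow> s \<in> U x \<Longrightarrow> t \<in> topspace K \<Longrightarrow> cmod (h (s, t) - h (x, t)) < d"
    by metis
  obtain X where X: "finite X" "X \<subseteq> topspace K" "topspace K \<subseteq> (\<Union>x\<in>X. U x)"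
    using compact_space_finite_subcover[OF compact_K U(1)] by blast
  obtain P \<phi> where P: "finite P" "P \<subseteq> topspace K"
    "\<And>p. p \<in> P \<Longrightarrow> continuous_map K euclideanreal (\<phi> p)"
    "\<And>p s. p \<in> P \<Longrightarrow> s \<in> topspace K \<Longrightarrow> 0 \<le> \<phi> p s"
    "\<And>s. s \<in> topspace K \<Longrightarrow> (\<Sum>p\<in>P. \<phi> p s) = 1"
    "\<And>p s f. p \<in> P \<Longrightarrow> s \<in> topspace K \<Longrightarrow> \<phi> p s \<noteq> 0 \<Longrightarrow> f \<in> (\<lambda>x t. h (x, t)) ` X \<Longrightarrow> cmod (f s - f p) < d"
    by (rule partition_of_unity_oscillation[OF compact_K, of "(\<lambda>x t. h (x, t)) ` X" d])
       (use X d h2 in auto)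
  have "\<exists>F\<in>E. \<forall>s\<in>topspace K. \<Phi> F s = complex_of_real (\<phi> p s)" if "p \<in> P" for p
    by (rule Phi_onto_ex[OF continuous_map_complex_of_real[OF P(3)[OF that]]])
  then obtain \<Psi> where \<Psi>: "\<And>p. p \<in> P \<Longrightarrow> \<Psi> p \<in> E"
    "\<And>p s. p \<in> P \<Longrightarrow> s \<in> topspace K \<Longrightarrow> \<Phi> (\<Psi> p) s = complex_of_real (\<phi> p s)"
    by metis
  have "\<exists>F\<in>E. \<forall>s\<in>topspace K. \<Phi> F s = h (s, p)" if "p \<in> P" for p
    using P(2) that by (intro Phi_onto_ex h1) blast
  then obtain A where A: "\<And>p. p \<in> P \<Longrightarrow> A p \<in> E"
    "\<And>p s. p \<in> P \<Longrightarrow> s \<in> topspace K \<Longrightarrow> \<Phi> (A p) s = h (s, p)"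
    by metis
  define V where "V = (\<Sum>p\<in>P. tensor (A p) (\<Psi> p))"
  have V: "V \<in> inj_tensor E E"
    unfolding V_def using A \<Psi> by (intro tensor_sums_inj_tensor tensor_sums_sum tensor_in_tensor_sums) auto
  have "cmod (h (s, t) - \<Theta> V (s, t)) \<le> e" if s: "s \<in> topspace K" and t: "t \<in> topspace K" for s t
  proof -
    have "\<Theta> V (s, t) = (\<Sum>p\<in>P. h (s, p) * complex_of_real (\<phi> p t))"
      unfolding V_def using Theta_sum[of P "\<lambda>p. tensor (A p) (\<Psi> p)" s t] A \<Psi> s t
      by (simp add: tensor_inj_tensor Theta_tensor)
    also have "cmod (h (s, t) - \<dots>) \<le> e"
    proof (rule cmod_convex_sum_le)
      fix p assume p: "p \<in> P" "\<phi> p t \<noteq> 0"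
      obtain x where x: "x \<in> X" "s \<in> U x" using X s by blast
      have "x \<in> topspace K" "p \<in> topspace K" using x p X P by auto
      \<comment> \<open>Exchanging \<open>s\<close> for \<open>x\<close> costs \<open>d\<close> at
        each of the second arguments \<open>t\<close> and \<open>p\<close>; moving from
        \<open>t\<close> to \<open>p\<close> costs a third \<open>d\<close>.\<close>
      then have 1: "dist (h (s, t)) (h (x, t)) < d" "dist (h (s, p)) (h (x, p)) < d"
        using U(2) x t by (auto simp: dist_norm)
      have 2: "dist (h (x, t)) (h (x, p)) < d"
        using P(6)[OF p(1) t p(2) imageI[OF x(1)]] by (simp add: dist_norm)
      have "dist (h (s, t)) (h (s, p)) \<le> 3 * d" using 1 2 by metric
      then show "cmod (h (s, t) - h (s, p)) \<le> e" by (simp add: dist_norm d_def)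
    qed (use P t in auto)
    finally show ?thesis .
  qed
  then show ?thesis using V by blast
qed

text \<open>Approximants that converge uniformly on the product are Cauchy in norm, because
  \<open>norm_le_Theta\<close> controls the norm by the values of \<open>\<Theta>\<close>; their
  limit stays in the closed tensor product.\<close>

lemma Theta_onto:
  assumes h: "continuous_map (prod_topology K K) euclidean h"
  shows "\<exists>W\<in>inj_tensor E E. \<forall>s\<in>topspace K. \<forall>t\<in>topspace K. \<Theta> W (s, t) = h (s, t)"
proof -
  have "\<exists>V\<in>inj_tensor E E. \<forall>s\<in>topspace K. \<forall>t\<in>topspace K. cmod (h (s, t) - \<Theta> V (s, t)) \<le> inverse (real (Suc n))" for n
    by (rule Theta_dense[OF h]) simp
  then obtain V where V: "\<And>n. V n \<in> inj_tensor E E"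
    "\<And>n s t. s \<in> topspace K \<Longrightarrow> t \<in> topspace K \<Longrightarrow> cmod (h (s, t) - \<Theta> (V n) (s, t)) \<le> inverse (real (Suc n))"
    by metis
  have near: "norm (V m - V n) \<le> 2 * inverse (real (Suc N))" if "N \<le> m" "N \<le> n" for m n N
  proof (rule norm_le_Theta[OF inj_tensor_E_diff[OF V(1) V(1)]])
    fix s t assume st: "s \<in> topspace K" "t \<in> topspace K"
    have inv: "inverse (real (Suc m)) \<le> inverse (real (Suc N))" "inverse (real (Suc n)) \<le> inverse (real (Suc N))"
      using that by (auto intro!: le_imp_inverse_le)
    have "dist (h (s, t)) (\<Theta> (V m) (s, t)) \<le> inverse (real (Suc N))" "dist (h (s, t)) (\<Theta> (V n) (s, t)) \<le> inverse (real (Suc N))"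
      unfolding dist_norm using V(2)[OF st] inv order_trans by blast+
    then have "dist (\<Theta> (V m) (s, t)) (\<Theta> (V n) (s, t)) \<le> 2 * inverse (real (Suc N))" by metric
    then show "cmod (\<Theta> (V m - V n) (s, t)) \<le> 2 * inverse (real (Suc N))"
      using V(1) st by (simp add: Theta_diff dist_norm)
  qed simp
  have "Cauchy V"
  proof (rule metric_CauchyI)
    fix e :: real assume "0 < e"
    then obtain N where "inverse (real (Suc N)) < e / 2" using reals_Archimedean[of "e / 2"] by auto
    then have "\<forall>m\<ge>N. \<forall>n\<ge>N. dist (V m) (V n) < e"
      using near by (fastforce simp: dist_norm)
    then show "\<exists>N. \<forall>m\<ge>N. \<forall>n\<ge>N. dist (V m) (V n) < e" by blast
  qed
  then obtain W where lim: "V \<longlonglongrightarrow> W" using Cauchy_convergent convergent_def by blast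
  have W: "W \<in> inj_tensor E E"
    using closed_sequentially[OF _ V(1) lim] by (simp add: inj_tensor_def)
  have "\<Theta> W (s, t) = h (s, t)" if st: "s \<in> topspace K" "t \<in> topspace K" for s t
  proof -
    have "(\<lambda>n. h (s, t) - \<Theta> (V n) (s, t)) \<longlonglongrightarrow> 0"
      by (rule Lim_null_comparison[OF _ LIMSEQ_inverse_real_of_nat]) (use V(2)[OF st] in auto)
    then have "(\<lambda>n. h (s, t) - (h (s, t) - \<Theta> (V n) (s, t))) \<longlonglongrightarrow> h (s, t) - 0"
      by (intro tendsto_intros)
    then show ?thesis using Theta_tendsto[OF V(1) W lim st] LIMSEQ_unique by simp
  qed
  then show ?thesis using W by blast
qed

lemma Theta_bij: "bij_betw \<Theta> (inj_tensor E E) (C_space (prod_topology K K))"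
  unfolding bij_betw_def
proof (intro conjI set_eqI iffI inj_onI)
  fix V W assume VW: "V \<in> inj_tensor E E" "W \<in> inj_tensor E E" "\<Theta> V = \<Theta> W"
  then have "norm (V - W) \<le> 0"
    by (intro norm_le_Theta inj_tensor_E_diff) (auto simp: Theta_diff)
  then show "V = W" by simp
next
  fix h assume "h \<in> \<Theta> ` inj_tensor E E"
  then show "h \<in> C_space (prod_topology K K)"
    using Theta_continuous by (auto simp: C_space_def \<Theta>_def)
next
  fix h assume h: "h \<in> C_space (prod_topology K K)"
  then obtain W where W: "W \<in> inj_tensor E E" "\<forall>s\<in>topspace K. \<forall>t\<in>topspace K. \<Theta> W (s, t) = h (s, t)"
    using Theta_onto[of h] by (auto simp: C_space_def)
  have "\<Theta> W = h"
  proof (rule extensionalityI[of _ "topspace K \<times> topspace K"])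
    show "h \<in> extensional (topspace K \<times> topspace K)" using h by (simp add: C_space_def)
    show "\<Theta> W \<in> extensional (topspace K \<times> topspace K)" unfolding \<Theta>_def by (rule restrict_extensional)
  qed (use W in auto)
  then show "h \<in> \<Theta> ` inj_tensor E E" using W(1) by blast
qed

lemma Theta_norm:
  assumes W: "W \<in> inj_tensor E E"
  shows "sup_norm (prod_topology K K) (\<Theta> W) = norm W"
proof (rule antisym)
  show "sup_norm (prod_topology K K) (\<Theta> W) \<le> norm W"
    using Theta_le[OF W] by (intro sup_norm_le) auto
  have le: "cmod (\<Theta> W z) \<le> sup_norm (prod_topology K K) (\<Theta> W)" if "z \<in> topspace (prod_topology K K)" for z
    using that compact_K by (intro cmod_le_sup_norm Theta_continuous W) (simp_all add: compact_space_prod_topology)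
  \<comment> \<open>\<open>norm_le_Theta\<close> requires a nonnegative bound; for empty
    \<open>K\<close> it comes from the \<open>insert 0\<close> in \<open>sup_norm\<close>.\<close>
  have "0 \<le> sup_norm (prod_topology K K) (\<Theta> W)"
  proof (cases "topspace K = {}")
    case False
    then obtain s where "s \<in> topspace K" by blast
    then show ?thesis by (intro order_trans[OF norm_ge_zero le[of "(s, s)"]]) simp
  qed (simp add: sup_norm_def)
  then show "norm W \<le> sup_norm (prod_topology K K) (\<Theta> W)"
    using le by (intro norm_le_Theta W) auto
qed

end

section \<open>The semigroup structure\<close>

locale comm_hopf_von_neumann_AP =
  comm_hopf_von_neumann mul star one mul2 star2 one2 \<Delta>
  for mul :: "('a::complex_banach \<Rightarrow>\<^sub>L complex) \<Rightarrow> ('a \<Rightarrow>\<^sub>L complex) \<Rightarrow> ('a \<Rightarrow>\<^sub>L complex)"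
    and star one mul2 star2 one2 \<Delta> +
  fixes K :: "'k topology" and \<Phi> :: "('a \<Rightarrow>\<^sub>L complex) \<Rightarrow> 'k \<Rightarrow> complex"
  assumes compact_space_K: "compact_space K" and Hausdorff_K: "Hausdorff_space K"
    and iso: "iso_onto_C (AP \<Delta>) mul star K \<Phi>"

sublocale comm_hopf_von_neumann_AP \<subseteq> isometric_function_space "AP \<Delta>" K \<Phi>
  by standard
     (use iso in \<open>auto simp: iso_onto_C_def compact_space_K closed_AP AP_add AP_scale AP_subset[THEN subsetD]\<close>)

context comm_hopf_von_neumann_AP
begin

lemma Delta_inj_tensor: "F \<in> AP \<Delta> \<Longrightarrow> \<Delta> F \<in> inj_tensor (AP \<Delta>) (AP \<Delta>)"
  by (intro inj_tensorI Delta_apply_AP slice_left_Delta_AP) (auto simp: AP_iff Delta_closed)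

lemma Delta_inj_tensor_cdual: "F \<in> AP \<Delta> \<Longrightarrow> \<Delta> F \<in> inj_tensor cdual cdual"
  using Delta_inj_tensor inj_tensor_mono[OF AP_subset AP_subset] by blast

text \<open>\<open>iso_onto_C\<close> prescribes \<open>\<Phi>\<close> on a product but does not say
  that the product is almost periodic. Multiplicativity of \<open>\<Delta>\<close> places
  \<open>\<Delta> (mul F G)\<close> in the closure of the tensor sums, where every form is
  compact.\<close>

lemma AP_mult:
  assumes "F \<in> AP \<Delta>" "G \<in> AP \<Delta>"
  shows "mul F G \<in> AP \<Delta>"
proof -
  have "F \<in> cdual" "G \<in> cdual" using assms AP_subset by auto
  moreover have "mul2 (\<Delta> F) (\<Delta> G) \<in> inj_tensor cdual cdual"
    using assms by (intro mul2_inj_tensor L.mult_closed Delta_inj_tensor_cdual) auto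
  ultimately show ?thesis
    by (simp add: AP_iff L.mult_closed Delta_mult compact_op_inj_tensor)
qed

lemma AP_star:
  assumes "F \<in> AP \<Delta>"
  shows "star F \<in> AP \<Delta>"
proof -
  have "F \<in> cdual" using assms AP_subset by auto
  moreover have "star2 (\<Delta> F) \<in> inj_tensor cdual cdual"
    using assms by (intro star2_inj_tensor L.star_closed Delta_inj_tensor_cdual) auto
  ultimately show ?thesis
    by (simp add: AP_iff L.star_closed Delta_star compact_op_inj_tensor)
qed

lemma Phi_mult: "F \<in> AP \<Delta> \<Longrightarrow> G \<in> AP \<Delta> \<Longrightarrow> s \<in> topspace K \<Longrightarrow> \<Phi> (mul F G) s = \<Phi> F s * \<Phi> G s"
  using iso unfolding iso_onto_C_def by simp

lemma Phi_star: "F \<in> AP \<Delta> \<Longrightarrow> s \<in> topspace K \<Longrightarrow> \<Phi> (star F) s = cnj (\<Phi> F s)"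
  using iso unfolding iso_onto_C_def by simp

text \<open>Unitality comes from surjectivity: multiply \<open>one\<close> by the preimage of the
  constant function 1.\<close>

lemma Phi_one:
  assumes s: "s \<in> topspace K"
  shows "\<Phi> one s = 1"
proof -
  obtain F where F: "F \<in> AP \<Delta>" "\<And>s. s \<in> topspace K \<Longrightarrow> \<Phi> F s = 1"
    using Phi_onto[of "\<lambda>_. 1"] by auto
  have "mul one F = F" using L.one_mult F(1) AP_subset by blast
  then show ?thesis using Phi_mult[OF AP_one F(1) s] F(2)[OF s] by simp
qed

lemma inj_tensor_mul2:
  "V \<in> inj_tensor (AP \<Delta>) (AP \<Delta>) \<Longrightarrow> W \<in> inj_tensor (AP \<Delta>) (AP \<Delta>) \<Longrightarrow> mul2 V W \<in> inj_tensor (AP \<Delta>) (AP \<Delta>)"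
  by (rule mul2_inj_tensor[OF AP_subset AP_mult])

lemma inj_tensor_star2:
  "W \<in> inj_tensor (AP \<Delta>) (AP \<Delta>) \<Longrightarrow> star2 W \<in> inj_tensor (AP \<Delta>) (AP \<Delta>)"
  by (rule star2_inj_tensor[OF AP_subset AP_star])

text \<open>\<open>mul2\<close> is prescribed on elementary tensors. Distributivity in each factor
  extends the identity to finite sums, and continuity of \<open>mul2\<close> and
  \<open>\<Theta>\<close> to their limits.\<close>

lemma Theta_mult:
  assumes V: "V \<in> inj_tensor (AP \<Delta>) (AP \<Delta>)" and W: "W \<in> inj_tensor (AP \<Delta>) (AP \<Delta>)"
    and s: "s \<in> topspace K" and t: "t \<in> topspace K"
  shows "\<Theta> (mul2 V W) (s, t) = \<Theta> V (s, t) * \<Theta> W (s, t)"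
proof -
  note simps = Theta_add[OF _ _ s t] Theta_tensor[OF _ _ s t] Theta_0[OF s t]
    tensor_sums_inj_tensor tensor_inj_tensor inj_tensor_mul2 AP_mult
    Phi_mult[OF _ _ s] Phi_mult[OF _ _ t] inj_tensor_cbil inj_tensor_add
  have 1: "\<Theta> (mul2 V (tensor F G)) (s, t) = \<Theta> V (s, t) * \<Theta> (tensor F G) (s, t)"
    if "V \<in> tensor_sums (AP \<Delta>) (AP \<Delta>)" and FG: "F \<in> AP \<Delta>" "G \<in> AP \<Delta>" for V F G
    using that(1)
  proof (induction rule: tensor_sums_induct)
    case zero
    show ?case using FG by (simp add: simps mul2_0)
  next
    case (add V F' G')
    have "mul2 (tensor F' G') (tensor F G) = tensor (mul F' F) (mul G' G)"
      using FG add AP_subset by (intro tensor_mult) auto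
    then have "mul2 (V + tensor F' G') (tensor F G) = mul2 V (tensor F G) + tensor (mul F' F) (mul G' G)"
      using FG add by (simp add: mul2_add_left simps)
    then show ?case
      using FG add.IH add.hyps by (simp add: simps algebra_simps)
  qed
  have 2: "\<Theta> (mul2 V W) (s, t) = \<Theta> V (s, t) * \<Theta> W (s, t)"
    if V: "V \<in> tensor_sums (AP \<Delta>) (AP \<Delta>)" and "W \<in> tensor_sums (AP \<Delta>) (AP \<Delta>)" for V W
    using that(2)
  proof (induction rule: tensor_sums_induct)
    case zero
    show ?case using V by (simp add: simps mul2_0)
  next
    case (add W F G)
    have "mul2 V (W + tensor F G) = mul2 V W + mul2 V (tensor F G)"
      using V add by (intro LL.mult_add) (auto simp: simps)
    then show ?case
      using V add.IH add.hyps 1[OF V, of F G] by (simp add: simps algebra_simps)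
  qed
  obtain Vn where Vn: "\<And>n. Vn n \<in> tensor_sums (AP \<Delta>) (AP \<Delta>)" "Vn \<longlonglongrightarrow> V"
    using inj_tensor_sequence V by blast
  obtain Wn where Wn: "\<And>n. Wn n \<in> tensor_sums (AP \<Delta>) (AP \<Delta>)" "Wn \<longlonglongrightarrow> W"
    using inj_tensor_sequence W by blast
  have "(\<lambda>n. \<Theta> (mul2 (Vn n) (Wn n)) (s, t)) \<longlonglongrightarrow> \<Theta> (mul2 V W) (s, t)"
    using V W Vn Wn by (intro Theta_tendsto[OF _ _ _ s t] mul2_tendsto) (auto simp: simps)
  moreover have "(\<lambda>n. \<Theta> (Vn n) (s, t) * \<Theta> (Wn n) (s, t)) \<longlonglongrightarrow> \<Theta> V (s, t) * \<Theta> W (s, t)"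
    using V W Vn Wn by (intro tendsto_mult Theta_tendsto[OF _ _ _ s t]) (auto simp: simps)
  ultimately show ?thesis
    using 2 Vn(1) Wn(1) LIMSEQ_unique by simp
qed

lemma Theta_star:
  assumes W: "W \<in> inj_tensor (AP \<Delta>) (AP \<Delta>)"
    and s: "s \<in> topspace K" and t: "t \<in> topspace K"
  shows "\<Theta> (star2 W) (s, t) = cnj (\<Theta> W (s, t))"
proof -
  note simps = Theta_add[OF _ _ s t] Theta_tensor[OF _ _ s t] Theta_0[OF s t]
    tensor_sums_inj_tensor tensor_inj_tensor inj_tensor_star2 AP_star
    Phi_star[OF _ s] Phi_star[OF _ t] inj_tensor_cbil inj_tensor_add
  have 1: "\<Theta> (star2 W) (s, t) = cnj (\<Theta> W (s, t))"
    if "W \<in> tensor_sums (AP \<Delta>) (AP \<Delta>)" for W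
    using that
  proof (induction rule: tensor_sums_induct)
    case zero
    show ?case by (simp add: simps star2_0)
  next
    case (add W F G)
    have "star2 (tensor F G) = tensor (star F) (star G)"
      using add AP_subset by (intro tensor_star) auto
    then have "star2 (W + tensor F G) = star2 W + tensor (star F) (star G)"
      using add by (simp add: LL.star_add simps)
    then show ?case
      using add.IH add.hyps by (simp add: simps)
  qed
  obtain Wn where Wn: "\<And>n. Wn n \<in> tensor_sums (AP \<Delta>) (AP \<Delta>)" "Wn \<longlonglongrightarrow> W"
    using inj_tensor_sequence W by blast
  have "(\<lambda>n. \<Theta> (star2 (Wn n)) (s, t)) \<longlonglongrightarrow> \<Theta> (star2 W) (s, t)"
    using W Wn by (intro Theta_tendsto[OF _ _ _ s t] star2_tendsto) (auto simp: simps)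
  moreover have "(\<lambda>n. cnj (\<Theta> (Wn n) (s, t))) \<longlonglongrightarrow> cnj (\<Theta> W (s, t))"
    using W Wn by (intro tendsto_cnj Theta_tendsto[OF _ _ _ s t]) (auto simp: simps)
  ultimately show ?thesis
    using 1 Wn(1) LIMSEQ_unique by simp
qed

lemma Theta_iso: "iso_onto_C (inj_tensor (AP \<Delta>) (AP \<Delta>)) mul2 star2 (prod_topology K K) \<Theta>"
  unfolding iso_onto_C_def
  using Theta_bij by (auto simp: Theta_add Theta_scale Theta_mult Theta_star Theta_norm)

section \<open>Characters, separation of points and the topology of \<open>K\<close>\<close>

text \<open>If no point represents \<open>\<psi>\<close>, then for each \<open>p\<close> some
  \<open>F\<close> gives a kernel element, the squared modulus of \<open>F\<close> minus
  \<open>\<psi> F\<close> times \<open>one\<close>, that is nonnegative on \<open>K\<close> and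
  nonzero at \<open>p\<close>. By compactness finitely many of them sum to a nowhere vanishing,
  hence invertible, element of the kernel, contradicting \<open>\<psi> one = 1\<close>.\<close>

lemma character_is_evaluation:
  assumes add: "\<And>F G. F \<in> AP \<Delta> \<Longrightarrow> G \<in> AP \<Delta> \<Longrightarrow> \<psi> (F + G) = \<psi> F + \<psi> G"
    and scale: "\<And>c F. F \<in> AP \<Delta> \<Longrightarrow> \<psi> (c *\<^sub>C F) = c * \<psi> F"
    and mult: "\<And>F G. F \<in> AP \<Delta> \<Longrightarrow> G \<in> AP \<Delta> \<Longrightarrow> \<psi> (mul F G) = \<psi> F * \<psi> G"
    and one: "\<psi> one = (1::complex)"
  shows "\<exists>p\<in>topspace K. \<forall>F\<in>AP \<Delta>. \<psi> F = \<Phi> F p"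
proof (rule ccontr)
  assume contra: "\<not> ?thesis"
  have "\<forall>p\<in>topspace K. \<exists>G. G \<in> AP \<Delta> \<and> \<psi> G = 0 \<and>
      (\<forall>s\<in>topspace K. \<exists>r\<ge>0. \<Phi> G s = complex_of_real r) \<and> \<Phi> G p \<noteq> 0"
  proof
    fix p assume p: "p \<in> topspace K"
    obtain F where F: "F \<in> AP \<Delta>" "\<psi> F \<noteq> \<Phi> F p" using contra p by blast
    define X where "X = F + (- \<psi> F) *\<^sub>C one"
    have X: "X \<in> AP \<Delta>" using F by (auto simp: X_def intro: AP_add AP_scale AP_one)
    have "\<psi> X = 0" using F by (simp add: X_def add scale AP_scale AP_one one)
    then have "\<psi> (mul (star X) X) = 0" using X by (simp add: mult AP_star)
    moreover have eq: "\<Phi> (mul (star X) X) s = complex_of_real ((cmod (\<Phi> X s))\<^sup>2)" if "s \<in> topspace K" for s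
    proof -
      have "\<Phi> (mul (star X) X) s = \<Phi> X s * cnj (\<Phi> X s)"
        using X that by (simp add: Phi_mult Phi_star AP_star)
      then show ?thesis by (simp only: complex_norm_square)
    qed
    then have "\<forall>s\<in>topspace K. \<exists>r\<ge>0. \<Phi> (mul (star X) X) s = complex_of_real r"
      by (metis zero_le_power2)
    moreover have "\<Phi> X p \<noteq> 0"
      using F p by (simp add: X_def Phi_add Phi_scale AP_scale AP_one Phi_one)
    then have "\<Phi> (mul (star X) X) p \<noteq> 0" by (simp add: eq[OF p])
    moreover have "mul (star X) X \<in> AP \<Delta>" by (intro AP_mult AP_star X)
    ultimately show "\<exists>G. G \<in> AP \<Delta> \<and> \<psi> G = 0 \<and>
      (\<forall>s\<in>topspace K. \<exists>r\<ge>0. \<Phi> G s = complex_of_real r) \<and> \<Phi> G p \<noteq> 0"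
      by (intro exI[of _ "mul (star X) X"] conjI)
  qed
  from bchoice[OF this] obtain G where *: "\<forall>p\<in>topspace K. G p \<in> AP \<Delta> \<and> \<psi> (G p) = 0 \<and>
      (\<forall>s\<in>topspace K. \<exists>r\<ge>0. \<Phi> (G p) s = complex_of_real r) \<and> \<Phi> (G p) p \<noteq> 0"
    by (elim exE)
  have G: "G p \<in> AP \<Delta>" "\<psi> (G p) = 0" "\<Phi> (G p) p \<noteq> 0"
      "s \<in> topspace K \<Longrightarrow> \<exists>r\<ge>0. \<Phi> (G p) s = complex_of_real r" if "p \<in> topspace K" for p s
    using *[THEN bspec, OF that] by simp_all
  define U where "U p = {s \<in> topspace K. \<Phi> (G p) s \<in> - {0}}" for p
  have "openin K (U p) \<and> p \<in> U p" if "p \<in> topspace K" for p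
  proof
    show "openin K (U p)"
      unfolding U_def by (rule openin_continuous_map_preimage[OF Phi_continuous[OF G(1)[OF that]]]) auto
    show "p \<in> U p" using that G(3) by (simp add: U_def)
  qed
  then obtain P where P: "finite P" "P \<subseteq> topspace K" "topspace K \<subseteq> (\<Union>p\<in>P. U p)"
    using compact_space_finite_subcover[OF compact_space_K] by blast
  define S where "S = (\<Sum>p\<in>P. G p)"
  have S: "S \<in> AP \<Delta>" unfolding S_def using P G by (intro E_sum) auto
  have psi0: "\<psi> 0 = 0" using scale[OF AP_one, of 0] by simp
  have "\<psi> (\<Sum>p\<in>Q. G p) = 0" if "Q \<subseteq> P" for Q
    using finite_subset[OF that P(1)] that
  proof (induction Q rule: finite_induct)
    case (insert x Q)
    then have "G x \<in> AP \<Delta>" "\<psi> (G x) = 0" "(\<Sum>p\<in>Q. G p) \<in> AP \<Delta>" "\<psi> (\<Sum>p\<in>Q. G p) = 0"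
      using G(1,2) P(2) by (auto intro!: E_sum)
    then show ?case using insert.hyps by (simp add: add)
  qed (simp add: psi0)
  then have psiS: "\<psi> S = 0" unfolding S_def by blast
  have nz: "\<Phi> S s \<noteq> 0" if s: "s \<in> topspace K" for s
  proof -
    have sum: "\<Phi> S s = (\<Sum>p\<in>P. \<Phi> (G p) s)" unfolding S_def using P G s by (intro Phi_sum) auto
    have Re: "0 \<le> Re (\<Phi> (G p) s)" "complex_of_real (Re (\<Phi> (G p) s)) = \<Phi> (G p) s" if "p \<in> P" for p
    proof -
      have "p \<in> topspace K" using P(2) that by blast
      from G(4)[OF this s] obtain r where "0 \<le> r" "\<Phi> (G p) s = complex_of_real r" by (elim exE conjE)
      then show "0 \<le> Re (\<Phi> (G p) s)" "complex_of_real (Re (\<Phi> (G p) s)) = \<Phi> (G p) s" by simp_all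
    qed
    obtain p where p: "p \<in> P" "\<Phi> (G p) s \<noteq> 0" using P(3) s by (auto simp: U_def)
    have "0 < (\<Sum>p\<in>P. Re (\<Phi> (G p) s))"
      using Re p P(1) by (intro sum_pos2[of P p]) (auto simp: less_le complex_eq_iff)
    moreover have "Re (\<Phi> S s) = (\<Sum>p\<in>P. Re (\<Phi> (G p) s))" by (simp add: sum)
    ultimately show ?thesis by fastforce
  qed
  have "continuous_map K euclidean (\<lambda>s. inverse (\<Phi> S s))"
    using Phi_continuous[OF S] nz by (simp add: continuous_map_atin tendsto_inverse)
  then obtain H where H: "H \<in> AP \<Delta>" "\<And>s. s \<in> topspace K \<Longrightarrow> \<Phi> H s = inverse (\<Phi> S s)"
    using Phi_onto by blast
  have "mul S H = one"
    using S H nz by (intro Phi_inject) (auto simp: AP_mult AP_one Phi_mult Phi_one)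
  then show False using mult[OF S H(1)] psiS one by simp
qed

text \<open>Complete regularity of compact Hausdorff spaces, carried over to
  \<open>AP \<Delta>\<close>. It serves both to separate points and to test continuity of maps into
  \<open>K\<close>.\<close>

lemma separating_function:
  assumes "openin K U" "p \<in> U"
  shows "\<exists>F\<in>AP \<Delta>. \<Phi> F p = 0 \<and> (\<forall>s\<in>topspace K - U. \<Phi> F s = 1)"
proof -
  have cr: "completely_regular_space K"
    using compact_space_K Hausdorff_K
    by (simp add: normal_imp_completely_regular_space compact_Hausdorff_or_regular_imp_normal_space)
  have "closedin K (topspace K - U) \<and> p \<in> topspace K - (topspace K - U)"
    using assms openin_subset by auto
  from cr[unfolded completely_regular_space_def, THEN spec, THEN spec, THEN mp, OF this]
  obtain f where f: "continuous_map K (top_of_set {0..1::real}) f" "f p = 0" "f ` (topspace K - U) \<subseteq> {1}"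
    by (elim exE conjE)
  have "continuous_map K euclidean (\<lambda>s. complex_of_real (f s))"
    by (rule continuous_map_complex_of_real[OF continuous_map_into_fulltopology[OF f(1)]])
  then obtain F where "F \<in> AP \<Delta>" "\<And>s. s \<in> topspace K \<Longrightarrow> \<Phi> F s = complex_of_real (f s)"
    using Phi_onto by blast
  moreover have "p \<in> topspace K" using assms openin_subset by blast
  ultimately show ?thesis using f(2,3) by (intro bexI[of _ F]) auto
qed

lemma AP_separates_points:
  assumes "p \<in> topspace K" "q \<in> topspace K" "\<And>F. F \<in> AP \<Delta> \<Longrightarrow> \<Phi> F p = \<Phi> F q"
  shows "p = q"
proof (rule ccontr)
  assume "p \<noteq> q"
  have "closedin K {q}" using Hausdorff_K assms(2) by (simp add: closedin_Hausdorff_singleton)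
  then have "openin K (topspace K - {q})" by blast
  then obtain F where F: "F \<in> AP \<Delta>" "\<Phi> F p = 0" "\<forall>s\<in>topspace K - (topspace K - {q}). \<Phi> F s = 1"
    using separating_function[of "topspace K - {q}" p] \<open>p \<noteq> q\<close> assms(1) by auto
  then have "\<Phi> F q = 1" using assms(2) by simp
  then show False using assms(3)[OF F(1)] F(2) by simp
qed

section \<open>The product on \<open>K\<close>: existence, joint continuity, associativity\<close>

definition prod_K :: "'k \<Rightarrow> 'k \<Rightarrow> 'k" where
  "prod_K s t = (SOME p. p \<in> topspace K \<and> (\<forall>F\<in>AP \<Delta>. \<Theta> (\<Delta> F) (s, t) = \<Phi> F p))"

lemma prod_K:
  assumes s: "s \<in> topspace K" and t: "t \<in> topspace K"
  shows prod_K_closed: "prod_K s t \<in> topspace K"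
    and Theta_Delta: "F \<in> AP \<Delta> \<Longrightarrow> \<Theta> (\<Delta> F) (s, t) = \<Phi> F (prod_K s t)"
proof -
  have "\<exists>p\<in>topspace K. \<forall>F\<in>AP \<Delta>. \<Theta> (\<Delta> F) (s, t) = \<Phi> F p"
  proof (rule character_is_evaluation)
    have cd: "F \<in> cdual" if "F \<in> AP \<Delta>" for F using that AP_subset by blast
    show "\<Theta> (\<Delta> (F + G)) (s, t) = \<Theta> (\<Delta> F) (s, t) + \<Theta> (\<Delta> G) (s, t)" if "F \<in> AP \<Delta>" "G \<in> AP \<Delta>" for F G
      using that s t by (simp add: cd Delta_add Theta_add Delta_inj_tensor)
    show "\<Theta> (\<Delta> (c *\<^sub>C F)) (s, t) = c * \<Theta> (\<Delta> F) (s, t)" if "F \<in> AP \<Delta>" for c F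
      using that s t by (simp add: cd Delta_scale Theta_scale Delta_inj_tensor)
    show "\<Theta> (\<Delta> (mul F G)) (s, t) = \<Theta> (\<Delta> F) (s, t) * \<Theta> (\<Delta> G) (s, t)" if "F \<in> AP \<Delta>" "G \<in> AP \<Delta>" for F G
      using that s t by (simp add: cd Delta_mult Theta_mult Delta_inj_tensor)
    show "\<Theta> (\<Delta> one) (s, t) = 1"
      using s t Theta_tensor[OF AP_one AP_one s t] by (simp add: Delta_one tensor_one Phi_one)
  qed
  then have "\<exists>p. p \<in> topspace K \<and> (\<forall>F\<in>AP \<Delta>. \<Theta> (\<Delta> F) (s, t) = \<Phi> F p)" by blast
  then have *: "prod_K s t \<in> topspace K \<and> (\<forall>F\<in>AP \<Delta>. \<Theta> (\<Delta> F) (s, t) = \<Phi> F (prod_K s t))"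
    unfolding prod_K_def by (rule someI_ex)
  show "prod_K s t \<in> topspace K" using * by blast
  show "F \<in> AP \<Delta> \<Longrightarrow> \<Theta> (\<Delta> F) (s, t) = \<Phi> F (prod_K s t)" using * by blast
qed

text \<open>A function that is 0 at the product and 1 off \<open>U\<close> pulls back to the jointly
  continuous \<open>\<Theta> (\<Delta> F)\<close>; the open set where the latter has modulus below 1
  is mapped into \<open>U\<close>.\<close>

lemma prod_K_continuous: "continuous_map (prod_topology K K) K (\<lambda>(s, t). prod_K s t)"
  unfolding continuous_map_def
proof (intro conjI allI impI)
  show "(\<lambda>(s, t). prod_K s t) \<in> topspace (prod_topology K K) \<rightarrow> topspace K"
    by (auto simp: prod_K_closed)
  fix U assume U: "openin K U"
  show "openin (prod_topology K K) {x \<in> topspace (prod_topology K K). (case x of (s, t) \<Rightarrow> prod_K s t) \<in> U}"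
    (is "openin _ ?V")
  proof (subst openin_subopen, intro ballI)
    fix z assume z: "z \<in> ?V"
    obtain s t where st: "z = (s, t)" "s \<in> topspace K" "t \<in> topspace K" "prod_K s t \<in> U"
      using z by auto
    obtain F where F: "F \<in> AP \<Delta>" "\<Phi> F (prod_K s t) = 0" "\<forall>s\<in>topspace K - U. \<Phi> F s = 1"
      using separating_function[OF U st(4)] by blast
    define N where "N = {x \<in> topspace (prod_topology K K). \<Theta> (\<Delta> F) x \<in> ball 0 1}"
    have "openin (prod_topology K K) N"
      unfolding N_def
      by (rule openin_continuous_map_preimage[OF Theta_continuous[OF Delta_inj_tensor[OF F(1)]]]) simp
    moreover have "z \<in> N" using st F by (simp add: N_def Theta_Delta)
    moreover have "N \<subseteq> ?V"
    proof
      fix x assume x: "x \<in> N"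
      then obtain u v where uv: "x = (u, v)" "u \<in> topspace K" "v \<in> topspace K"
        by (auto simp: N_def)
      then have "cmod (\<Phi> F (prod_K u v)) < 1" using x F by (simp add: N_def Theta_Delta)
      moreover have "\<Phi> F (prod_K u v) = 1" if "prod_K u v \<notin> U"
        using F(3) prod_K_closed[OF uv(2,3)] that by simp
      ultimately have "prod_K u v \<in> U" by fastforce
      then show "x \<in> ?V" using uv by simp
    qed
    ultimately show "\<exists>T. openin (prod_topology K K) T \<and> z \<in> T \<and> T \<subseteq> ?V" by blast
  qed
qed

text \<open>Coassociativity cannot be evaluated at \<open>t\<close> directly. It is first rewritten
  as \<open>\<Delta> F (conv \<Delta> a b) = \<Delta> (\<Delta> F a) b\<close>, an equality of
  elements of \<open>AP \<Delta>\<close>, whose images under \<open>\<Phi>\<close> can be compared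
  at \<open>t\<close>.\<close>

lemma Delta_slice_at:
  assumes F: "F \<in> AP \<Delta>" and t: "t \<in> topspace K"
  shows "\<Delta> (slice_at t (\<Delta> F)) a = slice_at t (\<Delta> (\<Delta> F a))"
proof (rule blinfun_eqI)
  fix b
  have Fc: "F \<in> cdual" using F AP_subset by blast
  have "\<Delta> F (conv \<Delta> a b) = \<Delta> (\<Delta> F a) b"
  proof (rule blinfun_eqI)
    fix c
    have "\<Delta> F (conv \<Delta> a b) c = slice_left (\<Delta> F) c (conv \<Delta> a b)" by simp
    also have "\<dots> = \<Delta> (slice_left (\<Delta> F) c) a b"
      by (intro conv_apply cbil_slice_left Delta_closed Fc)
    also have "\<dots> = \<Delta> (\<Delta> F a) b c" by (simp add: coassoc_apply Fc)
    finally show "\<Delta> F (conv \<Delta> a b) c = \<Delta> (\<Delta> F a) b c" .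
  qed
  moreover have "slice_at t (\<Delta> F) \<in> cdual"
    using slice_at_E[OF Delta_inj_tensor[OF F] t] AP_subset by blast
  ultimately show "\<Delta> (slice_at t (\<Delta> F)) a b = slice_at t (\<Delta> (\<Delta> F a)) b"
    using F t by (simp add: slice_at_inj_tensor_apply Delta_inj_tensor Delta_apply_AP flip: conv_apply)
qed

text \<open>\<open>H\<close> is the right translate of \<open>F\<close> by \<open>t\<close>. Slicing
  \<open>\<Delta> H\<close> at \<open>s\<close> gives the right translate of \<open>F\<close> by
  \<open>prod_K s t\<close>, and evaluating at \<open>r\<close> compares the two
  bracketings.\<close>

lemma prod_K_assoc:
  assumes r: "r \<in> topspace K" and s: "s \<in> topspace K" and t: "t \<in> topspace K"
  shows "prod_K (prod_K r s) t = prod_K r (prod_K s t)"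
proof (rule AP_separates_points)
  fix F assume F: "F \<in> AP \<Delta>"
  define H where "H = slice_at t (\<Delta> F)"
  have H: "H \<in> AP \<Delta>" unfolding H_def by (intro slice_at_E Delta_inj_tensor F t)
  have slice: "slice_at s (\<Delta> H) = slice_at (prod_K s t) (\<Delta> F)"
  proof (rule blinfun_eqI)
    fix a
    have "slice_at s (\<Delta> H) a = \<Phi> (slice_at t (\<Delta> (\<Delta> F a))) s"
      using H s Delta_slice_at[OF F t, of a] by (simp add: slice_at_inj_tensor_apply Delta_inj_tensor H_def)
    also have "\<dots> = \<Phi> (\<Delta> F a) (prod_K s t)"
      using s t Theta_Delta[OF s t Delta_apply_AP[OF F]] by (simp add: Theta_apply)
    also have "\<dots> = slice_at (prod_K s t) (\<Delta> F) a"
      using F s t by (simp add: slice_at_inj_tensor_apply Delta_inj_tensor prod_K_closed)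
    finally show "slice_at s (\<Delta> H) a = slice_at (prod_K s t) (\<Delta> F) a" .
  qed
  have "\<Phi> F (prod_K (prod_K r s) t) = \<Phi> H (prod_K r s)"
    using r s t F by (simp add: H_def prod_K_closed flip: Theta_apply Theta_Delta)
  also have "\<dots> = \<Phi> (slice_at s (\<Delta> H)) r"
    using r s H by (simp flip: Theta_apply Theta_Delta)
  also have "\<dots> = \<Phi> F (prod_K r (prod_K s t))"
    unfolding slice using r s t F by (simp add: prod_K_closed flip: Theta_apply Theta_Delta)
  finally show "\<Phi> F (prod_K (prod_K r s) t) = \<Phi> F (prod_K r (prod_K s t))" .
qed (use assms in \<open>auto intro: prod_K_closed\<close>)

end

text \<open>Although quantified existentially, \<open>\<Theta>\<close> is the canonical
  identification: its values on elementary tensors, with linearity and isometry, determine it on the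
  closure. The clause on \<open>m'\<close> expresses that the product is the only one with this
  property; it compares values on \<open>topspace K\<close> because \<open>m\<close> is arbitrary
  elsewhere.\<close>

theorem theorem3p1:
  fixes mul :: "('a::complex_banach \<Rightarrow>\<^sub>L complex) \<Rightarrow> ('a \<Rightarrow>\<^sub>L complex) \<Rightarrow> ('a \<Rightarrow>\<^sub>L complex)"
    and star :: "('a \<Rightarrow>\<^sub>L complex) \<Rightarrow> ('a \<Rightarrow>\<^sub>L complex)"
    and one :: "'a \<Rightarrow>\<^sub>L complex"
    and mul2 :: "('a \<Rightarrow>\<^sub>L 'a \<Rightarrow>\<^sub>L complex) \<Rightarrow> ('a \<Rightarrow>\<^sub>L 'a \<Rightarrow>\<^sub>L complex) \<Rightarrow> ('a \<Rightarrow>\<^sub>L 'a \<Rightarrow>\<^sub>L complex)"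
    and star2 :: "('a \<Rightarrow>\<^sub>L 'a \<Rightarrow>\<^sub>L complex) \<Rightarrow> ('a \<Rightarrow>\<^sub>L 'a \<Rightarrow>\<^sub>L complex)"
    and one2 :: "'a \<Rightarrow>\<^sub>L 'a \<Rightarrow>\<^sub>L complex"
    and \<Delta> :: "('a \<Rightarrow>\<^sub>L complex) \<Rightarrow> ('a \<Rightarrow>\<^sub>L 'a \<Rightarrow>\<^sub>L complex)"
    and K :: "'k topology"
    and \<Phi> :: "('a \<Rightarrow>\<^sub>L complex) \<Rightarrow> 'k \<Rightarrow> complex"
  assumes hopf: "comm_hopf_von_neumann mul star one mul2 star2 one2 \<Delta>"
    and K: "compact_space K" "Hausdorff_space K"
    and Phi: "iso_onto_C (AP \<Delta>) mul star K \<Phi>"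
  shows "\<Delta> ` AP \<Delta> \<subseteq> inj_tensor (AP \<Delta>) (AP \<Delta>) \<and>
    (\<exists>\<Theta> :: ('a \<Rightarrow>\<^sub>L 'a \<Rightarrow>\<^sub>L complex) \<Rightarrow> 'k \<times> 'k \<Rightarrow> complex.
       iso_onto_C (inj_tensor (AP \<Delta>) (AP \<Delta>)) mul2 star2 (prod_topology K K) \<Theta> \<and>
       (\<forall>F\<in>AP \<Delta>. \<forall>G\<in>AP \<Delta>. \<forall>s\<in>topspace K. \<forall>t\<in>topspace K.
          \<Theta> (tensor F G) (s, t) = \<Phi> F s * \<Phi> G t) \<and>
       (\<exists>m :: 'k \<Rightarrow> 'k \<Rightarrow> 'k.
          continuous_map (prod_topology K K) K (\<lambda>(s, t). m s t) \<and>
          (\<forall>r\<in>topspace K. \<forall>s\<in>topspace K. \<forall>t\<in>topspace K. m (m r s) t = m r (m s t)) \<and>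
          (\<forall>F\<in>AP \<Delta>. \<forall>s\<in>topspace K. \<forall>t\<in>topspace K. \<Theta> (\<Delta> F) (s, t) = \<Phi> F (m s t)) \<and>
          (\<forall>m' :: 'k \<Rightarrow> 'k \<Rightarrow> 'k.
             (\<forall>s\<in>topspace K. \<forall>t\<in>topspace K. m' s t \<in> topspace K) \<and>
             (\<forall>F\<in>AP \<Delta>. \<forall>s\<in>topspace K. \<forall>t\<in>topspace K. \<Theta> (\<Delta> F) (s, t) = \<Phi> F (m' s t)) \<longrightarrow>
             (\<forall>s\<in>topspace K. \<forall>t\<in>topspace K. m' s t = m s t))))"
proof -
  interpret comm_hopf_von_neumann_AP mul star one mul2 star2 one2 \<Delta> K \<Phi>
    by (intro comm_hopf_von_neumann_AP.intro comm_hopf_von_neumann_AP_axioms.intro hopf K Phi)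
  show ?thesis
  proof (intro conjI exI[of _ \<Theta>] exI[of _ prod_K] ballI allI impI)
    fix m' :: "'k \<Rightarrow> 'k \<Rightarrow> 'k" and s t
    assume m': "(\<forall>s\<in>topspace K. \<forall>t\<in>topspace K. m' s t \<in> topspace K) \<and>
        (\<forall>F\<in>AP \<Delta>. \<forall>s\<in>topspace K. \<forall>t\<in>topspace K. \<Theta> (\<Delta> F) (s, t) = \<Phi> F (m' s t))"
      and st: "s \<in> topspace K" "t \<in> topspace K"
    \<comment> \<open>Every \<open>\<Phi> F\<close> takes the same value at both products, and
      \<open>AP \<Delta>\<close> separates the points of \<open>K\<close>.\<close>
    then show "m' s t = prod_K s t"
      by (intro AP_separates_points prod_K_closed) (auto simp flip: Theta_Delta)
  qed (auto simp: Delta_inj_tensor Theta_iso Theta_tensor prod_K_continuous prod_K_assoc Theta_Delta)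
qed

end
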